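(* Let $f:\mathbb{R}\to\mathbb{R}$ be $L$-Lipschitz smooth, $\mu$-strongly convex and bounded from below. Let $b_n,c_n\in\mathbb{R}^n$ ($n\in\mathbb{N}$) satisfy $\|b_n\|_\infty,\|b_n\|_1,\|c_n\|_\infty,\|c_n\|_1=\Theta(1)$, and let $G_n\in\mathbb{R}^{n\times n}$ be a random matrix whose entries are independent standard normal variables. Set $A_n=G_n^{-1}$ and $B_n=I_n$, and consider the family of physical design problems $\{(f,c_n,\varphi_n\equiv(A_n,B_n,b_n)):n\in\mathbb{N}\}$. Then: (a) for every $\varepsilon>0$, with probability at least $1-2\exp(-\varepsilon^2/2)$, $\|A_n^{-1}\|_2\le 2\sqrt n+\varepsilon$; (b) $\mathrm{E}\big(\|B_n^{\mathrm T}(A_n^{-1}b_n\odot A_n^{-\mathrm T}c_n)\|_2^2\big)\ge\Omega(n)$; (c) $\mathrm{E}\big(|c_n^{\mathrm T}A_n^{-1}b_n|^2\big)\le O(1)$. Consequently this family on average satisfies the $(1/2,1/2)$-asymptotic convergence conditions, i.e. conditions (A), (C), (D), (E) of that definition (see context) hold, while (B), (F), (G) with $\alpha=\gamma=1/2$ hold in the probabilistic/averaged sense of (a), (b), (c) respectively.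
   Context: $\|v\|_p$ is the $l^p$ norm of a vector; $\|M\|_p$ is the induced $l^p$ operator norm of a matrix; $\odot$ is the elementwise product of vectors; $I_n$ is the identity matrix. Asymptotics are as $n\to\infty$: $a_n\le O(g(n))$ (resp. $a_n\ge\Omega(g(n))$) means there is $C>0$ with $a_n\le Cg(n)$ (resp. $a_n\ge Cg(n)$) for all large $n$; $\Theta$ means both. $f$ is $L$-Lipschitz smooth if it is differentiable and $|f'(x)-f'(y)|\le L|x-y|$; $\mu$-strongly convex ($\mu>0$) if $f(y)\ge f(x)+f'(x)(y-x)+\frac{\mu}{2}|x-y|^2$. A physical system $\varphi\equiv(A,B,b)$ of state size $n$ and parameter size $m$ ($A\in\mathbb{R}^{n\times n}$, $B\in\mathbb{R}^{n\times m}$, $b\in\mathbb{R}^n$) is the map $\varphi(\theta)=(A+\mathrm{diag}(B\theta))^{-1}b$ on $\{\theta\in\mathbb{R}^m:A+\mathrm{diag}(B\theta)\text{ invertible}\}$. A physical design problem $(f,c,\varphi)$ is the minimization of $f(c^{\mathrm T}\varphi(\theta))$ over this domain; a family of physical design problems is a sequence of problems $(f,c_n,\varphi_n)$ of state size $n$ with $f$ independent of $n$. $(\alpha,\gamma)$-asymptotic convergence conditions: (A) $f$ is $L$-Lipschitz smooth, $\mu$-strongly convex and bounded from below; (B) $\|A_n^{-1}\|_2\le O(n^\gamma)$; (C) $\|B_n\|_\infty,\|B_n\|_1,\|B_n\|_2\le O(1)$; (D) $\|b_n\|_\infty,\|b_n\|_1\le O(1)$; (E) $\|c_n\|_\infty,\|c_n\|_1\le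 O(1)$; (F) $\|B_n^{\mathrm T}(A_n^{-1}b_n\odot A_n^{-\mathrm T}c_n)\|_2^2\ge\Omega(n^{\alpha+\gamma})$; (G) $|c_n^{\mathrm T}A_n^{-1}b_n|\le O(1)$. *)

theory Defs
  imports
    "HOL-Probability.Probability"
    "HOL-Library.Landau_Symbols"
    "Jordan_Normal_Form.Matrix"
    "Jordan_Normal_Form.Gauss_Jordan_Elimination"
begin

text \<open>
  The state size varies along a family, so vectors and matrices are those of
  \<^theory>\<open>Jordan_Normal_Form.Matrix\<close>, whose dimensions are explicit naturals.
\<close>

definition l1_norm :: "real vec \<Rightarrow> real" where
  "l1_norm v = (\<Sum>i<dim_vec v. \<bar>vec_index v i\<bar>)"

definition l2_norm :: "real vec \<Rightarrow> real" where
  "l2_norm v = sqrt (\<Sum>i<dim_vec v. (vec_index v i)\<^sup>2)"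

definition linf_norm :: "real vec \<Rightarrow> real" where
  "linf_norm v = Max (insert 0 ((\<lambda>i. \<bar>vec_index v i\<bar>) ` {..<dim_vec v}))"

definition op_norm :: "(real vec \<Rightarrow> real) \<Rightarrow> real mat \<Rightarrow> real" where
  "op_norm N M = (SUP v\<in>{v \<in> carrier_vec (dim_col M). N v \<le> 1}. N (M *\<^sub>v v))"

definition elementwise_prod :: "real vec \<Rightarrow> real vec \<Rightarrow> real vec" (infixl "\<odot>" 70) where
  "v \<odot> w = vec (dim_vec v) (\<lambda>i. vec_index v i * vec_index w i)"

definition diag :: "real vec \<Rightarrow> real mat" where
  "diag v = mat_diag (dim_vec v) (vec_index v)"

text \<open>
  Total version of the inverse; a singular matrix is sent to the zero matrix.
\<close>

definition mat_inv :: "real mat \<Rightarrow> real mat" where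
  "mat_inv M = (case mat_inverse M of Some N \<Rightarrow> N | None \<Rightarrow> 0\<^sub>m (dim_col M) (dim_row M))"


definition lipschitz_smooth :: "real \<Rightarrow> (real \<Rightarrow> real) \<Rightarrow> bool" where
  "lipschitz_smooth L f \<longleftrightarrow>
     (\<forall>x. f differentiable (at x)) \<and> (\<forall>x y. \<bar>deriv f x - deriv f y\<bar> \<le> L * \<bar>x - y\<bar>)"

definition strongly_convex :: "real \<Rightarrow> (real \<Rightarrow> real) \<Rightarrow> bool" where
  "strongly_convex \<mu> f \<longleftrightarrow>
     \<mu> > 0 \<and> (\<forall>x y. f y \<ge> f x + deriv f x * (y - x) + \<mu> / 2 * \<bar>x - y\<bar>\<^sup>2)"


record physical_system =
  sys_A :: "real mat"
  sys_B :: "real mat"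
  sys_b :: "real vec"

definition is_physical_system :: "nat \<Rightarrow> nat \<Rightarrow> physical_system \<Rightarrow> bool" where
  "is_physical_system n m \<phi> \<longleftrightarrow>
     sys_A \<phi> \<in> carrier_mat n n \<and> sys_B \<phi> \<in> carrier_mat n m \<and> sys_b \<phi> \<in> carrier_vec n"

definition system_domain :: "physical_system \<Rightarrow> real vec set" where
  "system_domain \<phi> =
     {\<theta> \<in> carrier_vec (dim_col (sys_B \<phi>)). invertible_mat (sys_A \<phi> + diag (sys_B \<phi> *\<^sub>v \<theta>))}"

text \<open>Only meaningful on \<^const>\<open>system_domain\<close>.\<close>

definition system_map :: "physical_system \<Rightarrow> real vec \<Rightarrow> real vec" where
  "system_map \<phi> \<theta> = mat_inv (sys_A \<phi> + diag (sys_B \<phi> *\<^sub>v \<theta>)) *\<^sub>v sys_b \<phi>"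

record design_problem =
  objective :: "real \<Rightarrow> real"
  readout :: "real vec"
  system :: physical_system

definition design_loss :: "design_problem \<Rightarrow> real vec \<Rightarrow> real" where
  "design_loss P \<theta> = objective P (scalar_prod (readout P) (system_map (system P) \<theta>))"

text \<open>State sizes are the positive naturals; the member at index 0 is irrelevant.\<close>

definition is_design_family :: "(real \<Rightarrow> real) \<Rightarrow> (nat \<Rightarrow> design_problem) \<Rightarrow> bool" where
  "is_design_family f P \<longleftrightarrow>
     (\<forall>n>0. objective (P n) = f \<and> readout (P n) \<in> carrier_vec n \<and>
            (\<exists>m. is_physical_system n m (system (P n))))"


text \<open>
  The quantities bounded in conditions (B), (F) and (G): \<open>\<parallel>A\<inverse>\<parallel>\<^sub>2\<close>,
  \<open>\<parallel>B\<^sup>T (A\<inverse> b \<odot> A\<^sup>-\<^sup>T c)\<parallel>\<^sub>2\<^sup>2\<close> and \<open>\<bar>c\<^sup>T A\<inverse> b\<bar>\<close>.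
\<close>

definition inverse_norm :: "design_problem \<Rightarrow> real" where
  "inverse_norm P = op_norm l2_norm (mat_inv (sys_A (system P)))"

definition gradient_sq :: "design_problem \<Rightarrow> real" where
  "gradient_sq P =
     (let A_inv = mat_inv (sys_A (system P)) in
      (l2_norm (transpose_mat (sys_B (system P)) *\<^sub>v
         ((A_inv *\<^sub>v sys_b (system P)) \<odot> (transpose_mat A_inv *\<^sub>v readout P))))\<^sup>2)"

definition abs_output :: "design_problem \<Rightarrow> real" where
  "abs_output P =
     \<bar>scalar_prod (readout P) (mat_inv (sys_A (system P)) *\<^sub>v sys_b (system P))\<bar>"

text \<open>
  All sequences below are nonnegative, so the Landau symbols, which compare absolute values,
  express one-sided bounds on the sequences themselves.
\<close>

definition condition_A :: "real \<Rightarrow> real \<Rightarrow> (real \<Rightarrow> real) \<Rightarrow> bool" where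
  "condition_A L \<mu> f \<longleftrightarrow> lipschitz_smooth L f \<and> strongly_convex \<mu> f \<and> bdd_below (range f)"

definition condition_B :: "real \<Rightarrow> (nat \<Rightarrow> design_problem) \<Rightarrow> bool" where
  "condition_B \<gamma> P \<longleftrightarrow>
     (\<forall>n>0. invertible_mat (sys_A (system (P n)))) \<and>
     (\<lambda>n. inverse_norm (P n)) \<in> O(\<lambda>n. real n powr \<gamma>)"

definition condition_C :: "(nat \<Rightarrow> design_problem) \<Rightarrow> bool" where
  "condition_C P \<longleftrightarrow>
     (\<lambda>n. op_norm linf_norm (sys_B (system (P n)))) \<in> O(\<lambda>_. 1) \<and>
     (\<lambda>n. op_norm l1_norm (sys_B (system (P n)))) \<in> O(\<lambda>_. 1) \<and>
     (\<lambda>n. op_norm l2_norm (sys_B (system (P n)))) \<in> O(\<lambda>_. 1)"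

definition condition_D :: "(nat \<Rightarrow> design_problem) \<Rightarrow> bool" where
  "condition_D P \<longleftrightarrow>
     (\<lambda>n. linf_norm (sys_b (system (P n)))) \<in> O(\<lambda>_. 1) \<and>
     (\<lambda>n. l1_norm (sys_b (system (P n)))) \<in> O(\<lambda>_. 1)"

definition condition_E :: "(nat \<Rightarrow> design_problem) \<Rightarrow> bool" where
  "condition_E P \<longleftrightarrow>
     (\<lambda>n. linf_norm (readout (P n))) \<in> O(\<lambda>_. 1) \<and>
     (\<lambda>n. l1_norm (readout (P n))) \<in> O(\<lambda>_. 1)"

definition condition_F :: "real \<Rightarrow> real \<Rightarrow> (nat \<Rightarrow> design_problem) \<Rightarrow> bool" where
  "condition_F \<alpha> \<gamma> P \<longleftrightarrow> (\<lambda>n. gradient_sq (P n)) \<in> \<Omega>(\<lambda>n. real n powr (\<alpha> + \<gamma>))"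

definition condition_G :: "(nat \<Rightarrow> design_problem) \<Rightarrow> bool" where
  "condition_G P \<longleftrightarrow> (\<lambda>n. abs_output (P n)) \<in> O(\<lambda>_. 1)"

definition asymptotic_convergence_conditions ::
    "real \<Rightarrow> real \<Rightarrow> real \<Rightarrow> real \<Rightarrow> (real \<Rightarrow> real) \<Rightarrow> (nat \<Rightarrow> design_problem) \<Rightarrow> bool" where
  "asymptotic_convergence_conditions \<alpha> \<gamma> L \<mu> f P \<longleftrightarrow>
     is_design_family f P \<and> condition_A L \<mu> f \<and> condition_B \<gamma> P \<and> condition_C P \<and>
     condition_D P \<and> condition_E P \<and> condition_F \<alpha> \<gamma> P \<and> condition_G P"


text \<open>
  Averaged counterparts of (B), (F), (G) for a random family, given as a map from outcomes to
  families. Integrability is required explicitly because the Bochner integral of a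
  non-integrable function is 0.
\<close>

definition average_condition_B ::
    "'w measure \<Rightarrow> real \<Rightarrow> ('w \<Rightarrow> nat \<Rightarrow> design_problem) \<Rightarrow> bool" where
  "average_condition_B M \<gamma> P \<longleftrightarrow>
     (\<forall>n>0. AE \<omega> in M. invertible_mat (sys_A (system (P \<omega> n)))) \<and>
     (\<exists>C>0. \<forall>\<^sub>F n in sequentially. \<forall>\<epsilon>>0.
        measure M {\<omega> \<in> space M. inverse_norm (P \<omega> n) \<le> C * real n powr \<gamma> + \<epsilon>}
          \<ge> 1 - 2 * exp (- \<epsilon>\<^sup>2 / 2))"

definition average_condition_F ::
    "'w measure \<Rightarrow> real \<Rightarrow> real \<Rightarrow> ('w \<Rightarrow> nat \<Rightarrow> design_problem) \<Rightarrow> bool" where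
  "average_condition_F M \<alpha> \<gamma> P \<longleftrightarrow>
     (\<forall>n>0. integrable M (\<lambda>\<omega>. gradient_sq (P \<omega> n))) \<and>
     (\<lambda>n. \<integral>\<omega>. gradient_sq (P \<omega> n) \<partial>M) \<in> \<Omega>(\<lambda>n. real n powr (\<alpha> + \<gamma>))"

definition average_condition_G ::
    "'w measure \<Rightarrow> ('w \<Rightarrow> nat \<Rightarrow> design_problem) \<Rightarrow> bool" where
  "average_condition_G M P \<longleftrightarrow>
     (\<forall>n>0. integrable M (\<lambda>\<omega>. (abs_output (P \<omega> n))\<^sup>2)) \<and>
     (\<lambda>n. \<integral>\<omega>. (abs_output (P \<omega> n))\<^sup>2 \<partial>M) \<in> O(\<lambda>_. 1)"

definition average_asymptotic_convergence_conditions ::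
    "'w measure \<Rightarrow> real \<Rightarrow> real \<Rightarrow> real \<Rightarrow> real \<Rightarrow> (real \<Rightarrow> real) \<Rightarrow>
     ('w \<Rightarrow> nat \<Rightarrow> design_problem) \<Rightarrow> bool" where
  "average_asymptotic_convergence_conditions M \<alpha> \<gamma> L \<mu> f P \<longleftrightarrow>
     condition_A L \<mu> f \<and>
     (\<forall>\<omega>\<in>space M. is_design_family f (P \<omega>) \<and>
        condition_C (P \<omega>) \<and> condition_D (P \<omega>) \<and> condition_E (P \<omega>)) \<and>
     average_condition_B M \<gamma> P \<and> average_condition_F M \<alpha> \<gamma> P \<and> average_condition_G M P"


definition standard_normal_matrix :: "'w measure \<Rightarrow> nat \<Rightarrow> ('w \<Rightarrow> real mat) \<Rightarrow> bool" where
  "standard_normal_matrix M n X \<longleftrightarrow>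
     (\<forall>\<omega>\<in>space M. X \<omega> \<in> carrier_mat n n) \<and>
     prob_space.indep_vars M (\<lambda>_. borel) (\<lambda>ij \<omega>. X \<omega> $$ ij) ({..<n} \<times> {..<n}) \<and>
     (\<forall>i<n. \<forall>j<n. distributed M lborel (\<lambda>\<omega>. X \<omega> $$ (i, j)) std_normal_density)"

end

theory Submission
  imports Defs "Jordan_Normal_Form.Determinant" "HOL-Real_Asymp.Real_Asymp"
begin

text \<open>
Since \<open>B\<^sub>n\<close> is the identity and, almost surely, \<open>A\<^sub>n\<inverse> = G\<^sub>n\<close>, all claims concern the
Gaussian matrix \<open>G = G\<^sub>n\<close> itself. A singular \<open>G\<close> is sent to the zero matrix by the total
inverse; this happens with probability zero, because the determinant is a polynomial that is affine in
every entry and not identically zero (\<open>AE_gaussian_multiaffine_nonzero\<close>).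

The norm bound is the hard part. Write \<open>\<parallel>G\<parallel>\<close> as the supremum of \<open>u\<^sup>T G v\<close> over unit vectors
and compare this Gaussian process with the simpler process \<open>g\<^sup>T u + h\<^sup>T v\<close>, where \<open>g\<close>, \<open>h\<close> are
independent standard Gaussian vectors. With an additional independent normal variable \<open>z\<close>, the
variables \<open>u\<^sup>T G v + z\<close> and \<open>g\<^sup>T u + h\<^sup>T v\<close> both have variance 2, and the difference of the
covariances at \<open>(u, v)\<close> and \<open>(u', v')\<close> is \<open>(1 - u\<^sup>T u') (1 - v\<^sup>T v') \<ge> 0\<close>. By the Slepian-type
comparison \<open>gaussian_comparison\<close>, for every \<open>l > 0\<close>,
\<open>E exp (l (\<parallel>G\<parallel> + z)) \<le> E exp (l (|g| + |h|))\<close>.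
Dividing by \<open>E exp (l z) = exp (l\<^sup>2 / 2)\<close> and using \<open>E exp (l |g|) \<le> exp (l sqrt n + l\<^sup>2 / 2)\<close> gives
\<open>E exp (l \<parallel>G\<parallel>) \<le> exp (2 l sqrt n + l\<^sup>2 / 2)\<close>, and Markov's inequality with \<open>l = \<epsilon>\<close> yields
the tail bound \<open>exp (- \<epsilon>\<^sup>2 / 2)\<close> for \<open>\<parallel>G\<parallel> > 2 sqrt n + \<epsilon>\<close>. Suprema are replaced by maxima over
finite sets of pairs \<open>(u, v)\<close>, which increase to a countable dense set.

The comparison theorem is proved by interpolation. Along the path \<open>sin \<theta> X + cos \<theta> Y\<close> the expectation of
\<open>(\<Sum>\<^sub>t exp (\<beta> x\<^sub>t)) powr (l / \<beta>)\<close>, a smooth substitute for \<open>exp (l max\<^sub>t x\<^sub>t)\<close>, has a derivative that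
Stein's identity \<open>E (\<xi>\<^sub>k H) = E (\<partial>\<^sub>k H)\<close> turns into a sum of covariance differences times mixed second
partial derivatives; for \<open>l < \<beta>\<close> these partial derivatives are nonpositive.

Stein's identity also gives the moments: \<open>E (U\<^sup>2 V\<^sup>2) = \<langle>u, u\<rangle> \<langle>v, v\<rangle> + 2 \<langle>u, v\<rangle>\<^sup>2\<close> for linear forms
\<open>U\<close>, \<open>V\<close> with weights \<open>u\<close>, \<open>v\<close>. Applied to \<open>(G b)\<^sub>i\<close> and \<open>(G\<^sup>T c)\<^sub>i\<close> this bounds the expected squared
gradient below by \<open>n |b|\<^sup>2 |c|\<^sup>2\<close>, and \<open>E |c\<^sup>T G b|\<^sup>2 = |b|\<^sup>2 |c|\<^sup>2\<close>. The assumptions on the norms of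
\<open>b\<close>, \<open>c\<close> keep \<open>|b|\<close>, \<open>|c|\<close> between positive constants, since
\<open>\<parallel>b\<parallel>\<^sub>\<infinity>\<^sup>2 \<le> |b|\<^sup>2 \<le> \<parallel>b\<parallel>\<^sub>\<infinity> \<parallel>b\<parallel>\<^sub>1\<close>.
\<close>

section \<open>The standard Gaussian measure on the line\<close>

definition std_gaussian :: "real measure" where
  "std_gaussian = density lborel std_normal_density"

lemma space_std_gaussian [simp]: "space std_gaussian = UNIV"
  and sets_std_gaussian [simp, measurable_cong]: "sets std_gaussian = sets borel"
  by (auto simp: std_gaussian_def)

interpretation std_gaussian: prob_space std_gaussian
  unfolding std_gaussian_def by (rule prob_space_normal_density) simp

lemma has_bochner_integral_std_gaussian:
  assumes "has_bochner_integral lborel (\<lambda>x. std_normal_density x * h x) (v::real)"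
    and [measurable]: "h \<in> borel_measurable borel"
  shows "has_bochner_integral std_gaussian h v"
  using assms unfolding std_gaussian_def
  by (intro has_bochner_integral_density) auto

lemma std_gaussian_exp: "has_bochner_integral std_gaussian (\<lambda>x. exp (l * x)) (exp (l\<^sup>2 / 2))"
proof (rule has_bochner_integral_std_gaussian)
  have "std_normal_density x * exp (l * x) = exp (l\<^sup>2 / 2) * normal_density l 1 x" for x
    by (simp add: normal_density_def exp_add[symmetric] field_simps power2_eq_square)
  then show "has_bochner_integral lborel (\<lambda>x. std_normal_density x * exp (l * x)) (exp (l\<^sup>2 / 2))"
    by (simp add: has_bochner_integral_iff integral_normal_density integrable_normal_density)
qed measurable

text \<open>
The integrand times the standard density is, up to the factor, the density of variance \<open>1 / (1 - s)\<close>.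
\<close>

lemma std_gaussian_exp_square:
  assumes "s < 1"
  shows "has_bochner_integral std_gaussian (\<lambda>x. exp (s * x\<^sup>2 / 2)) (1 / sqrt (1 - s))"
proof (rule has_bochner_integral_std_gaussian)
  have "std_normal_density x * exp (s * x\<^sup>2 / 2) = 1 / sqrt (1 - s) * normal_density 0 (1 / sqrt (1 - s)) x" for x
  proof -
    have "exp (- x\<^sup>2 / 2) * exp (s * x\<^sup>2 / 2) = exp (- (x\<^sup>2 * (1 - s) / 2))"
      unfolding exp_add[symmetric] by (simp add: field_simps)
    then show ?thesis
      using assms by (simp add: normal_density_def power_divide real_sqrt_mult real_sqrt_divide field_simps)
  qed
  then show "has_bochner_integral lborel (\<lambda>x. std_normal_density x * exp (s * x\<^sup>2 / 2)) (1 / sqrt (1 - s))"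
    using assms by (simp add: has_bochner_integral_iff integral_normal_density integrable_normal_density)
qed measurable

lemma integrable_std_gaussian_exp_abs: "integrable std_gaussian (\<lambda>x. exp (c * \<bar>x\<bar>))"
proof (rule Bochner_Integration.integrable_bound)
  show "integrable std_gaussian (\<lambda>x. exp (c * x) + exp (- c * x))"
    using std_gaussian_exp[of c] std_gaussian_exp[of "- c"]
    by (intro Bochner_Integration.integrable_add) (auto simp: has_bochner_integral_iff)
  show "AE x in std_gaussian. norm (exp (c * \<bar>x\<bar>)) \<le> norm (exp (c * x) + exp (- c * x))"
  proof (rule AE_I2)
    fix x :: real
    have "exp (c * \<bar>x\<bar>) \<le> exp (c * x) + exp (- c * x)" by (cases "0 \<le> x") auto
    then show "norm (exp (c * \<bar>x\<bar>)) \<le> norm (exp (c * x) + exp (- c * x))"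
      unfolding real_norm_def by (simp only: abs_exp_cancel order.trans[OF _ abs_ge_self])
  qed
qed measurable

text \<open>
Stein's identity on the line. The standard density \<open>\<phi>\<close> satisfies \<open>\<phi>' x = - x \<phi> x\<close>, so
\<open>h' \<phi> - x h \<phi>\<close> is the derivative of \<open>h \<phi>\<close>, which vanishes at both infinities; the exponential
bounds make every term integrable.
\<close>

lemma std_gaussian_stein:
  fixes h h' :: "real \<Rightarrow> real"
  assumes deriv: "\<And>x. (h has_real_derivative h' x) (at x)"
    and cont: "\<And>x. isCont h' x"
    and h: "\<And>x. \<bar>h x\<bar> \<le> C * exp (c * \<bar>x\<bar>)"
    and h': "\<And>x. \<bar>h' x\<bar> \<le> C' * exp (c' * \<bar>x\<bar>)"
  shows "(\<integral>x. x * h x \<partial>std_gaussian) = (\<integral>x. h' x \<partial>std_gaussian)"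
proof -
  have cont_h: "isCont h x" for x using deriv DERIV_isCont by blast
  have [measurable]: "h \<in> borel_measurable borel" "h' \<in> borel_measurable borel"
    using cont_h cont by (auto intro!: borel_measurable_continuous_onI continuous_at_imp_continuous_on)
  have x_le: "\<bar>x\<bar> \<le> exp \<bar>x\<bar>" for x :: real
    using exp_ge_add_one_self[of "\<bar>x\<bar>"] by linarith
  have int: "integrable std_gaussian h'" "integrable std_gaussian (\<lambda>x. x * h x)"
  proof -
    show "integrable std_gaussian h'"
      by (rule Bochner_Integration.integrable_bound[OF integrable_mult_right[OF integrable_std_gaussian_exp_abs[of c'], of C']])
         (use h' in \<open>auto intro!: AE_I2 order.trans[OF _ abs_ge_self]\<close>)
    have "\<bar>x * h x\<bar> \<le> C * exp ((c + 1) * \<bar>x\<bar>)" for x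
    proof -
      have "\<bar>x * h x\<bar> \<le> exp \<bar>x\<bar> * (C * exp (c * \<bar>x\<bar>))"
        unfolding abs_mult by (intro mult_mono h x_le) auto
      then show ?thesis by (simp add: algebra_simps exp_add)
    qed
    then show "integrable std_gaussian (\<lambda>x. x * h x)"
      by (intro Bochner_Integration.integrable_bound[OF integrable_mult_right[OF integrable_std_gaussian_exp_abs[of "c+1"], of C]])
         (auto intro!: AE_I2 order.trans[OF _ abs_ge_self])
  qed
  let ?\<phi> = std_normal_density
  let ?F = "\<lambda>x. ?\<phi> x * h x"
  let ?f = "\<lambda>x. ?\<phi> x * h' x - ?\<phi> x * (x * h x)"
  have int_l: "integrable lborel (\<lambda>x. ?\<phi> x * h' x)" "integrable lborel (\<lambda>x. ?\<phi> x * (x * h x))"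
    using int unfolding std_gaussian_def by (auto simp: integrable_density)
  have "0 \<le> C" using h[of 0] by simp
  have bound: "norm (?F x) \<le> C * exp (c\<^sup>2) * exp (- x\<^sup>2 / 4)" for x
  proof -
    \<comment> \<open>Half of the Gaussian exponent absorbs the exponential growth of \<open>h\<close>.\<close>
    have "c * \<bar>x\<bar> \<le> c\<^sup>2 + x\<^sup>2 / 4"
      using zero_le_power2[of "c - \<bar>x\<bar> / 2"] by (simp add: power2_eq_square algebra_simps)
    then have "exp (- x\<^sup>2 / 2) * exp (c * \<bar>x\<bar>) \<le> exp (c\<^sup>2) * exp (- x\<^sup>2 / 4)"
      unfolding exp_add[symmetric] by simp
    then have le: "C * (exp (- x\<^sup>2 / 2) * exp (c * \<bar>x\<bar>)) \<le> C * (exp (c\<^sup>2) * exp (- x\<^sup>2 / 4))"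
      using \<open>0 \<le> C\<close> by (rule mult_left_mono)
    have "?\<phi> x \<le> exp (- x\<^sup>2 / 2)"
      unfolding std_normal_density_def
      using pi_ge_two by (intro mult_left_le_one_le) (auto simp: divide_simps)
    then have "\<bar>?\<phi> x\<bar> * \<bar>h x\<bar> \<le> exp (- x\<^sup>2 / 2) * (C * exp (c * \<bar>x\<bar>))"
      by (intro mult_mono h) auto
    with le show ?thesis by (simp add: abs_mult algebra_simps)
  qed
  have lim: "(?F \<longlongrightarrow> 0) A" if "((\<lambda>x. exp (- x\<^sup>2 / 4)) \<longlongrightarrow> 0) A" for A
    using always_eventually[OF allI[OF bound]] tendsto_mult_right_zero[OF that]
    by (rule Lim_null_comparison)
  have top: "(?F \<longlongrightarrow> 0) at_top" and bot: "(?F \<longlongrightarrow> 0) at_bot"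
    by (rule lim, real_asymp)+
  have \<phi>': "(?\<phi> has_real_derivative (- x * ?\<phi> x)) (at x)" for x
    unfolding std_normal_density_def
    by (rule DERIV_cong[OF DERIV_cmult[OF DERIV_exp[THEN DERIV_chain2]]]) (auto intro!: derivative_eq_intros)
  have "(LBINT x=-\<infinity>..\<infinity>. ?f x) = 0 - 0"
  proof (rule interval_integral_FTC_integrable)
    show "(?F has_vector_derivative ?f x) (at x)" for x
      unfolding has_real_derivative_iff_has_vector_derivative[symmetric]
      using deriv \<phi>' by (auto intro!: derivative_eq_intros simp: algebra_simps)
    show "isCont ?f x" for x
      using cont cont_h DERIV_isCont[OF \<phi>'] by (intro continuous_intros)
    show "set_integrable lborel (einterval (- \<infinity>) \<infinity>) ?f"
      using int_l by (auto simp: set_integrable_def intro!: Bochner_Integration.integrable_diff)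
    show "((?F \<circ> real_of_ereal) \<longlongrightarrow> 0) (at_right (- \<infinity>))" "((?F \<circ> real_of_ereal) \<longlongrightarrow> 0) (at_left \<infinity>)"
      using top bot by (auto simp: comp_def at_right_MInf at_left_PInf filterlim_filtermap)
  qed simp
  then have "(\<integral>x. ?f x \<partial>lborel) = 0"
    by (simp add: interval_lebesgue_integral_def set_lebesgue_integral_def)
  then have "(\<integral>x. ?\<phi> x * h' x \<partial>lborel) = (\<integral>x. ?\<phi> x * (x * h x) \<partial>lborel)"
    by (subst (asm) Bochner_Integration.integral_diff) (use int_l in auto)
  then show ?thesis
    unfolding std_gaussian_def by (simp add: integral_density)
qed

section \<open>Stein identity for finite families of Gaussian variables\<close>

definition gaussian :: "'i set \<Rightarrow> ('i \<Rightarrow> real) measure" where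
  "gaussian I = PiM I (\<lambda>_. std_gaussian)"

interpretation gaussian: product_prob_space "\<lambda>_. std_gaussian" I for I
  by standard

interpretation gaussian_prob: prob_space "gaussian I" for I
  unfolding gaussian_def by (rule gaussian.P.prob_space_axioms)

lemma sets_gaussian [measurable_cong]: "sets (gaussian I) = sets (PiM I (\<lambda>_. borel))"
  unfolding gaussian_def by (intro sets_PiM_cong) auto

lemma measurable_gaussian_component:
  "i \<in> I \<Longrightarrow> (\<lambda>\<xi>. \<xi> i) \<in> borel_measurable (gaussian I)"
  by measurable

text \<open>
One class of functions for which every integrability question below is settled at once. It is closed
under the algebraic operations and contains the linear forms and their exponentials. The bound is
required for all functions \<open>\<xi>\<close>, not only for the extensional ones that make up the space of the product
measure, so that updating a coordinate needs no side condition.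
\<close>

definition exp_growth :: "'i set \<Rightarrow> (('i \<Rightarrow> real) \<Rightarrow> real) \<Rightarrow> bool" where
  "exp_growth I H \<longleftrightarrow> H \<in> borel_measurable (gaussian I) \<and>
     (\<exists>C c. 0 \<le> C \<and> 0 \<le> c \<and> (\<forall>\<xi>. \<bar>H \<xi>\<bar> \<le> C * exp (c * (\<Sum>i\<in>I. \<bar>\<xi> i\<bar>))))"

lemma exp_growthI:
  "H \<in> borel_measurable (gaussian I) \<Longrightarrow> 0 \<le> C \<Longrightarrow> 0 \<le> c \<Longrightarrow>
   (\<And>\<xi>. \<bar>H \<xi>\<bar> \<le> C * exp (c * (\<Sum>i\<in>I. \<bar>\<xi> i\<bar>))) \<Longrightarrow> exp_growth I H"
  unfolding exp_growth_def by blast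

lemma exp_growthE:
  assumes "exp_growth I H"
  obtains C c where "0 \<le> C" "0 \<le> c" "\<And>\<xi>. \<bar>H \<xi>\<bar> \<le> C * exp (c * (\<Sum>i\<in>I. \<bar>\<xi> i\<bar>))"
  using assms unfolding exp_growth_def by blast

lemma exp_growth_measurable: "exp_growth I H \<Longrightarrow> H \<in> borel_measurable (gaussian I)"
  unfolding exp_growth_def by blast

lemma exp_growth_const: "exp_growth I (\<lambda>_. v)"
  by (rule exp_growthI[where C = "\<bar>v\<bar>" and c = 0]) auto

lemma exp_growth_component:
  assumes "finite I" "i \<in> I"
  shows "exp_growth I (\<lambda>\<xi>. \<xi> i)"
proof (rule exp_growthI[where C = 1 and c = 1])
  fix \<xi> :: "'a \<Rightarrow> real"
  have "\<bar>\<xi> i\<bar> \<le> (\<Sum>i\<in>I. \<bar>\<xi> i\<bar>)" using assms by (intro member_le_sum) auto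
  then show "\<bar>\<xi> i\<bar> \<le> 1 * exp (1 * (\<Sum>i\<in>I. \<bar>\<xi> i\<bar>))"
    using exp_ge_add_one_self[of "\<Sum>i\<in>I. \<bar>\<xi> i\<bar>"] by (simp del: exp_ge_add_one_self)
qed (use assms in auto)

lemma exp_growth_add:
  assumes H: "exp_growth I H" and K: "exp_growth I K"
  shows "exp_growth I (\<lambda>\<xi>. H \<xi> + K \<xi>)"
proof -
  have meas: "(\<lambda>\<xi>. H \<xi> + K \<xi>) \<in> borel_measurable (gaussian I)"
    by (intro borel_measurable_add exp_growth_measurable H K)
  obtain C c where 1: "0 \<le> C" "0 \<le> c" "\<And>\<xi>. \<bar>H \<xi>\<bar> \<le> C * exp (c * (\<Sum>i\<in>I. \<bar>\<xi> i\<bar>))"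
    using H by (rule exp_growthE) blast
  obtain D d where 2: "0 \<le> D" "0 \<le> d" "\<And>\<xi>. \<bar>K \<xi>\<bar> \<le> D * exp (d * (\<Sum>i\<in>I. \<bar>\<xi> i\<bar>))"
    using K by (rule exp_growthE) blast
  show ?thesis
  proof (rule exp_growthI[where C = "C + D" and c = "max c d"])
    fix \<xi> :: "'a \<Rightarrow> real"
    let ?s = "\<Sum>i\<in>I. \<bar>\<xi> i\<bar>"
    have s: "0 \<le> ?s" by (intro sum_nonneg) auto
    have "\<bar>H \<xi> + K \<xi>\<bar> \<le> C * exp (c * ?s) + D * exp (d * ?s)"
      using 1(3)[of \<xi>] 2(3)[of \<xi>] by linarith
    also have "\<dots> \<le> C * exp (max c d * ?s) + D * exp (max c d * ?s)"
      using 1 2 s by (intro add_mono mult_left_mono) (auto intro!: mult_right_mono)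
    finally show "\<bar>H \<xi> + K \<xi>\<bar> \<le> (C + D) * exp (max c d * ?s)" by (simp add: algebra_simps)
  qed (simp_all add: meas 1(1,2) 2(1,2) le_max_iff_disj)
qed

lemma exp_growth_mult:
  assumes H: "exp_growth I H" and K: "exp_growth I K"
  shows "exp_growth I (\<lambda>\<xi>. H \<xi> * K \<xi>)"
proof -
  have meas: "(\<lambda>\<xi>. H \<xi> * K \<xi>) \<in> borel_measurable (gaussian I)"
    by (intro borel_measurable_times exp_growth_measurable H K)
  obtain C c where 1: "0 \<le> C" "0 \<le> c" "\<And>\<xi>. \<bar>H \<xi>\<bar> \<le> C * exp (c * (\<Sum>i\<in>I. \<bar>\<xi> i\<bar>))"
    using H by (rule exp_growthE) blast
  obtain D d where 2: "0 \<le> D" "0 \<le> d" "\<And>\<xi>. \<bar>K \<xi>\<bar> \<le> D * exp (d * (\<Sum>i\<in>I. \<bar>\<xi> i\<bar>))"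
    using K by (rule exp_growthE) blast
  show ?thesis
  proof (rule exp_growthI[where C = "C * D" and c = "c + d"])
    fix \<xi> :: "'a \<Rightarrow> real"
    let ?s = "\<Sum>i\<in>I. \<bar>\<xi> i\<bar>"
    have "\<bar>H \<xi> * K \<xi>\<bar> \<le> (C * exp (c * ?s)) * (D * exp (d * ?s))"
      unfolding abs_mult using 1 2 by (intro mult_mono) auto
    then show "\<bar>H \<xi> * K \<xi>\<bar> \<le> (C * D) * exp ((c + d) * ?s)" by (simp add: algebra_simps exp_add)
  qed (simp_all add: meas 1(1,2) 2(1,2) le_max_iff_disj)
qed

lemma exp_growth_sum:
  "(\<And>t. t \<in> T \<Longrightarrow> exp_growth I (H t)) \<Longrightarrow> exp_growth I (\<lambda>\<xi>. \<Sum>t\<in>T. H t \<xi>)"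
  by (induction T rule: infinite_finite_induct) (auto intro: exp_growth_const exp_growth_add)

lemma exp_growth_power: "exp_growth I H \<Longrightarrow> exp_growth I (\<lambda>\<xi>. H \<xi> ^ m)"
  by (induction m) (auto intro: exp_growth_const exp_growth_mult)

lemma exp_growth_bound:
  assumes "exp_growth I K" "H \<in> borel_measurable (gaussian I)" "\<And>\<xi>. \<bar>H \<xi>\<bar> \<le> \<bar>K \<xi>\<bar>"
  shows "exp_growth I H"
proof -
  obtain C c where 1: "0 \<le> C" "0 \<le> c" "\<And>\<xi>. \<bar>K \<xi>\<bar> \<le> C * exp (c * (\<Sum>i\<in>I. \<bar>\<xi> i\<bar>))"
    using assms(1) by (rule exp_growthE) blast
  show ?thesis
    by (rule exp_growthI[OF assms(2) 1(1,2) order.trans[OF assms(3) 1(3)]])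
qed

lemma exp_growth_integrable:
  assumes "finite I" "exp_growth I H"
  shows "integrable (gaussian I) H"
proof -
  obtain C c where 1: "0 \<le> C" "0 \<le> c" "\<And>\<xi>. \<bar>H \<xi>\<bar> \<le> C * exp (c * (\<Sum>i\<in>I. \<bar>\<xi> i\<bar>))"
    using assms(2) by (rule exp_growthE) blast
  have "integrable (gaussian I) (\<lambda>\<xi>. \<Prod>i\<in>I. exp (c * \<bar>\<xi> i\<bar>))"
    unfolding gaussian_def
    by (intro gaussian.product_integrable_prod assms(1) integrable_std_gaussian_exp_abs)
  then have "integrable (gaussian I) (\<lambda>\<xi>. C * exp (c * (\<Sum>i\<in>I. \<bar>\<xi> i\<bar>)))"
    using assms(1) by (simp add: exp_sum sum_distrib_left)
  then show ?thesis
  proof (rule Bochner_Integration.integrable_bound)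
    show "AE \<xi> in gaussian I. norm (H \<xi>) \<le> norm (C * exp (c * (\<Sum>i\<in>I. \<bar>\<xi> i\<bar>)))"
      unfolding real_norm_def by (rule AE_I2, rule order.trans[OF 1(3) abs_ge_self])
  qed (rule exp_growth_measurable[OF assms(2)])
qed

lemma gaussian_integral_insert:
  fixes f :: "('i \<Rightarrow> real) \<Rightarrow> real"
  assumes "finite J" "k \<notin> J" "integrable (gaussian (insert k J)) f"
  shows "(\<integral>\<xi>. f \<xi> \<partial>gaussian (insert k J)) = (\<integral>\<xi>. (\<integral>x. f (\<xi>(k := x)) \<partial>std_gaussian) \<partial>gaussian J)"
  using assms unfolding gaussian_def by (rule gaussian.product_integral_insert)

text \<open>
By Fubini the one-dimensional identity can be applied in coordinate \<open>k\<close> with the others fixed.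
\<close>

lemma gaussian_stein:
  fixes H H' :: "('i \<Rightarrow> real) \<Rightarrow> real"
  assumes "finite I" "k \<in> I" and H: "exp_growth I H" and H': "exp_growth I H'"
    and deriv: "\<And>\<xi> x. ((\<lambda>y. H (\<xi>(k := y))) has_real_derivative H' (\<xi>(k := x))) (at x)"
    and cont: "\<And>\<xi> x. isCont (\<lambda>y. H' (\<xi>(k := y))) x"
  shows "(\<integral>\<xi>. \<xi> k * H \<xi> \<partial>gaussian I) = (\<integral>\<xi>. H' \<xi> \<partial>gaussian I)"
proof -
  define J where "J = I - {k}"
  have J: "finite J" "k \<notin> J" and I: "I = insert k J" using assms(1,2) by (auto simp: J_def)
  have int: "integrable (gaussian (insert k J)) (\<lambda>\<xi>. \<xi> k * H \<xi>)" "integrable (gaussian (insert k J)) H'"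
    unfolding I[symmetric] using assms(1,2) H H'
    by (auto intro!: exp_growth_integrable exp_growth_mult exp_growth_component)
  have bd: "\<exists>C c. \<forall>x. \<bar>K (\<xi>(k := x))\<bar> \<le> C * exp (c * \<bar>x\<bar>)" if K: "exp_growth I K" for K \<xi>
  proof -
    obtain C c where 1: "0 \<le> C" "0 \<le> c" "\<And>\<xi>. \<bar>K \<xi>\<bar> \<le> C * exp (c * (\<Sum>i\<in>I. \<bar>\<xi> i\<bar>))"
      using K by (rule exp_growthE) blast
    have "\<bar>K (\<xi>(k := x))\<bar> \<le> (C * exp (c * (\<Sum>i\<in>J. \<bar>\<xi> i\<bar>))) * exp (c * \<bar>x\<bar>)" for x
    proof -
      have "(\<Sum>i\<in>I. \<bar>(\<xi>(k := x)) i\<bar>) = \<bar>x\<bar> + (\<Sum>i\<in>J. \<bar>(\<xi>(k := x)) i\<bar>)"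
        unfolding I using J by simp
      also have "(\<Sum>i\<in>J. \<bar>(\<xi>(k := x)) i\<bar>) = (\<Sum>i\<in>J. \<bar>\<xi> i\<bar>)"
        using J by (intro sum.cong) auto
      finally show ?thesis using 1(3)[of "\<xi>(k := x)"] by (simp add: algebra_simps exp_add)
    qed
    then show ?thesis by blast
  qed
  have "(\<integral>x. (\<xi>(k := x)) k * H (\<xi>(k := x)) \<partial>std_gaussian) = (\<integral>x. H' (\<xi>(k := x)) \<partial>std_gaussian)" for \<xi>
  proof -
    obtain C c where "\<And>x. \<bar>H (\<xi>(k := x))\<bar> \<le> C * exp (c * \<bar>x\<bar>)" using bd[OF H, of \<xi>] by blast
    moreover obtain C' c' where "\<And>x. \<bar>H' (\<xi>(k := x))\<bar> \<le> C' * exp (c' * \<bar>x\<bar>)" using bd[OF H', of \<xi>] by blast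
    ultimately show ?thesis using deriv cont by (simp, intro std_gaussian_stein)
  qed
  then show ?thesis
    unfolding I by (simp add: gaussian_integral_insert[OF J int(1)] gaussian_integral_insert[OF J int(2)])
qed

definition linform :: "'i set \<Rightarrow> ('i \<Rightarrow> real) \<Rightarrow> ('i \<Rightarrow> real) \<Rightarrow> real" where
  "linform I w \<xi> = (\<Sum>k\<in>I. w k * \<xi> k)"

lemma linform_measurable [measurable]: "linform I w \<in> borel_measurable (gaussian I)"
  unfolding linform_def by measurable

lemma exp_growth_diff:
  assumes "exp_growth I H" "exp_growth I K"
  shows "exp_growth I (\<lambda>\<xi>. H \<xi> - K \<xi>)"
  using exp_growth_add[OF assms(1) exp_growth_mult[OF exp_growth_const[of I "-1"] assms(2)]] by simp

lemma exp_growth_linform: "finite I \<Longrightarrow> exp_growth I (linform I w)"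
  unfolding linform_def
  by (intro exp_growth_sum exp_growth_mult exp_growth_const exp_growth_component)

lemma linform_deriv:
  assumes "finite I" "k \<in> I"
  shows "((\<lambda>y. linform I w (\<xi>(k := y))) has_real_derivative w k) (at x)"
proof -
  have "(\<lambda>y. linform I w (\<xi>(k := y))) = (\<lambda>y. w k * y + (\<Sum>i\<in>I - {k}. w i * \<xi> i))"
  proof
    fix y
    have "(\<Sum>i\<in>I - {k}. w i * (\<xi>(k := y)) i) = (\<Sum>i\<in>I - {k}. w i * \<xi> i)"
      by (intro sum.cong) auto
    then show "linform I w (\<xi>(k := y)) = w k * y + (\<Sum>i\<in>I - {k}. w i * \<xi> i)"
      unfolding linform_def using assms by (simp add: sum.remove[of I k])
  qed
  then show ?thesis by (auto intro!: derivative_eq_intros)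
qed

lemma exp_growth_exp_linform:
  assumes "finite I"
  shows "exp_growth I (\<lambda>\<xi>. exp (linform I w \<xi>))"
proof (rule exp_growthI[where C = 1 and c = "\<Sum>k\<in>I. \<bar>w k\<bar>"])
  fix \<xi> :: "'a \<Rightarrow> real"
  have "linform I w \<xi> \<le> (\<Sum>k\<in>I. \<bar>w k\<bar> * \<bar>\<xi> k\<bar>)"
    unfolding linform_def by (intro sum_mono) (metis abs_ge_self abs_mult)
  also have "\<dots> \<le> (\<Sum>k\<in>I. \<bar>w k\<bar> * (\<Sum>i\<in>I. \<bar>\<xi> i\<bar>))"
    using assms by (intro sum_mono mult_left_mono member_le_sum) auto
  finally show "\<bar>exp (linform I w \<xi>)\<bar> \<le> 1 * exp ((\<Sum>k\<in>I. \<bar>w k\<bar>) * (\<Sum>i\<in>I. \<bar>\<xi> i\<bar>))"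
    by (simp add: sum_distrib_right)
qed (simp_all add: sum_nonneg measurable_compose[OF linform_measurable borel_measurable_exp])

lemma linform_cmult: "linform I (\<lambda>k. a * w k) \<xi> = a * linform I w \<xi>"
  unfolding linform_def by (simp add: sum_distrib_left mult.assoc)

section \<open>A smooth substitute for the exponential of a maximum\<close>

definition sum_exp :: "real \<Rightarrow> 't set \<Rightarrow> ('t \<Rightarrow> real) \<Rightarrow> real" where
  "sum_exp \<beta> T z = (\<Sum>t\<in>T. exp (\<beta> * z t))"

text \<open>
Because \<open>max\<^sub>t exp (\<beta> z\<^sub>t) \<le> \<Sum>\<^sub>t exp (\<beta> z\<^sub>t) \<le> card T * max\<^sub>t exp (\<beta> z\<^sub>t)\<close>, this differs from
\<open>exp (l max\<^sub>t z\<^sub>t)\<close> by a factor of at most \<open>card T powr (l / \<beta>)\<close>, which tends to 1 as \<open>\<beta>\<close> grows.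
\<close>

definition exp_smax :: "real \<Rightarrow> real \<Rightarrow> 't set \<Rightarrow> ('t \<Rightarrow> real) \<Rightarrow> real" where
  "exp_smax l \<beta> T z = sum_exp \<beta> T z powr (l / \<beta>)"

text \<open>
The partial derivative of \<open>exp_smax\<close> with respect to \<open>z\<^sub>t\<close>, divided by \<open>l\<close>.
\<close>

definition exp_smax1 :: "real \<Rightarrow> real \<Rightarrow> 't set \<Rightarrow> 't \<Rightarrow> ('t \<Rightarrow> real) \<Rightarrow> real" where
  "exp_smax1 l \<beta> T t z = exp (\<beta> * z t) * sum_exp \<beta> T z powr (l / \<beta> - 1)"

text \<open>
For \<open>s \<noteq> t\<close> the partial derivative of \<open>exp_smax1 l \<beta> T t\<close> with respect to \<open>z\<^sub>s\<close> is \<open>- (\<beta> - l)\<close> times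
this nonnegative function. The sign, which holds for \<open>l < \<beta>\<close>, drives the comparison theorem.
\<close>

definition exp_smax2 :: "real \<Rightarrow> real \<Rightarrow> 't set \<Rightarrow> 't \<Rightarrow> 't \<Rightarrow> ('t \<Rightarrow> real) \<Rightarrow> real" where
  "exp_smax2 l \<beta> T t s z = exp (\<beta> * z t) * exp (\<beta> * z s) * sum_exp \<beta> T z powr (l / \<beta> - 2)"

lemma sum_exp_pos: "finite T \<Longrightarrow> T \<noteq> {} \<Longrightarrow> 0 < sum_exp \<beta> T z"
  unfolding sum_exp_def by (intro sum_pos) auto

lemma exp_le_sum_exp: "finite T \<Longrightarrow> t \<in> T \<Longrightarrow> exp (\<beta> * z t) \<le> sum_exp \<beta> T z"
  unfolding sum_exp_def by (intro member_le_sum) auto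

lemma sum_exp_deriv:
  assumes "\<And>t. t \<in> T \<Longrightarrow> ((\<lambda>x. z x t) has_real_derivative z' t) (at x)"
  shows "((\<lambda>x. sum_exp \<beta> T (z x)) has_real_derivative (\<Sum>t\<in>T. \<beta> * z' t * exp (\<beta> * z x t))) (at x)"
  unfolding sum_exp_def by (auto intro!: derivative_eq_intros assms simp: mult_ac)

lemma exp_smax_deriv:
  assumes T: "finite T" "T \<noteq> {}" and "0 < \<beta>"
    and z': "\<And>t. t \<in> T \<Longrightarrow> ((\<lambda>x. z x t) has_real_derivative z' t) (at x)"
  shows "((\<lambda>x. exp_smax l \<beta> T (z x)) has_real_derivative
           l * (\<Sum>t\<in>T. z' t * exp_smax1 l \<beta> T t (z x))) (at x)"
proof -
  have "((\<lambda>x. exp_smax l \<beta> T (z x)) has_real_derivative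
          ((l / \<beta>) * sum_exp \<beta> T (z x) powr (l / \<beta> - 1)) * (\<Sum>t\<in>T. \<beta> * z' t * exp (\<beta> * z x t))) (at x)"
    unfolding exp_smax_def
    by (rule DERIV_chain2[OF has_real_derivative_powr[OF sum_exp_pos[OF T]] sum_exp_deriv[OF z']])
  also have "((l / \<beta>) * sum_exp \<beta> T (z x) powr (l / \<beta> - 1)) * (\<Sum>t\<in>T. \<beta> * z' t * exp (\<beta> * z x t))
     = l * (\<Sum>t\<in>T. z' t * exp_smax1 l \<beta> T t (z x))"
    unfolding exp_smax1_def sum_distrib_left using \<open>0 < \<beta>\<close> by (intro sum.cong refl) simp
  finally show ?thesis .
qed

lemma exp_smax1_deriv:
  assumes T: "finite T" "T \<noteq> {}" and "0 < \<beta>" and t: "t \<in> T"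
    and z': "\<And>t. t \<in> T \<Longrightarrow> ((\<lambda>x. z x t) has_real_derivative z' t) (at x)"
  shows "((\<lambda>x. exp_smax1 l \<beta> T t (z x)) has_real_derivative
           \<beta> * z' t * exp_smax1 l \<beta> T t (z x) - (\<beta> - l) * (\<Sum>s\<in>T. z' s * exp_smax2 l \<beta> T t s (z x))) (at x)"
proof -
  let ?S = "sum_exp \<beta> T (z x)"
  have 1: "((\<lambda>x. exp (\<beta> * z x t)) has_real_derivative \<beta> * z' t * exp (\<beta> * z x t)) (at x)"
    using t by (auto intro!: derivative_eq_intros z')
  have 2: "((\<lambda>x. sum_exp \<beta> T (z x) powr (l / \<beta> - 1)) has_real_derivative
          ((l / \<beta> - 1) * ?S powr (l / \<beta> - 1 - 1)) * (\<Sum>t\<in>T. \<beta> * z' t * exp (\<beta> * z x t))) (at x)"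
    by (rule DERIV_chain2[OF has_real_derivative_powr[OF sum_exp_pos[OF T]] sum_exp_deriv[OF z']])
  have "(l / \<beta> - 1) * ?S powr (l / \<beta> - 1 - 1) * (\<Sum>s\<in>T. \<beta> * z' s * exp (\<beta> * z x s)) * exp (\<beta> * z x t)
      = (\<Sum>s\<in>T. ((l / \<beta> - 1) * \<beta>) * (z' s * exp_smax2 l \<beta> T t s (z x)))"
    by (simp add: exp_smax2_def sum_distrib_left sum_distrib_right mult_ac)
  also have "\<dots> = - ((\<beta> - l) * (\<Sum>s\<in>T. z' s * exp_smax2 l \<beta> T t s (z x)))"
    using \<open>0 < \<beta>\<close> by (simp add: sum_distrib_left sum_negf[symmetric] algebra_simps)
  finally have eq: "(l / \<beta> - 1) * ?S powr (l / \<beta> - 1 - 1) * (\<Sum>s\<in>T. \<beta> * z' s * exp (\<beta> * z x s)) * exp (\<beta> * z x t)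
      = - ((\<beta> - l) * (\<Sum>s\<in>T. z' s * exp_smax2 l \<beta> T t s (z x)))" .
  have "\<beta> * z' t * exp (\<beta> * z x t) * ?S powr (l / \<beta> - 1) +
      (l / \<beta> - 1) * ?S powr (l / \<beta> - 1 - 1) * (\<Sum>t\<in>T. \<beta> * z' t * exp (\<beta> * z x t)) * exp (\<beta> * z x t)
    = \<beta> * z' t * exp_smax1 l \<beta> T t (z x) - (\<beta> - l) * (\<Sum>s\<in>T. z' s * exp_smax2 l \<beta> T t s (z x))"
    unfolding eq by (simp add: exp_smax1_def)
  then show ?thesis
    using DERIV_mult[OF 1 2] unfolding exp_smax1_def[of l \<beta> T t] by (simp only:)
qed

text \<open>
A crude bound, used only for integrability: a power with exponent below 1 is at most \<open>max 1 S \<le> 1 + S\<close>.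
\<close>

lemma exp_smax_le: "finite T \<Longrightarrow> T \<noteq> {} \<Longrightarrow> 0 < l \<Longrightarrow> l < \<beta> \<Longrightarrow> exp_smax l \<beta> T z \<le> 1 + sum_exp \<beta> T z"
proof -
  assume *: "finite T" "T \<noteq> {}" "0 < l" "l < \<beta>"
  then have S: "0 < sum_exp \<beta> T z" by (intro sum_exp_pos)
  show ?thesis
  proof (cases "sum_exp \<beta> T z \<le> 1")
    case True
    then have "exp_smax l \<beta> T z \<le> 1" unfolding exp_smax_def using S * by (intro powr_le1) auto
    then show ?thesis using S by simp
  next
    case False
    then have "exp_smax l \<beta> T z \<le> sum_exp \<beta> T z powr 1" unfolding exp_smax_def using * by (intro powr_mono) auto
    then show ?thesis using S by simp
  qed
qed

lemma exp_smax1_nonneg: "0 \<le> exp_smax1 l \<beta> T t z"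
  and exp_smax2_nonneg: "0 \<le> exp_smax2 l \<beta> T t s z"
  and exp_smax_nonneg: "0 \<le> exp_smax l \<beta> T z"
  by (auto simp: exp_smax_def exp_smax1_def exp_smax2_def)

lemma exp_smax1_le:
  assumes "finite T" "t \<in> T"
  shows "exp_smax1 l \<beta> T t z \<le> exp_smax l \<beta> T z"
proof -
  have S: "0 < sum_exp \<beta> T z" using assms by (intro sum_exp_pos) auto
  have "exp_smax1 l \<beta> T t z \<le> sum_exp \<beta> T z * sum_exp \<beta> T z powr (l / \<beta> - 1)"
    unfolding exp_smax1_def using assms by (intro mult_right_mono exp_le_sum_exp) auto
  also have "\<dots> = exp_smax l \<beta> T z" using S by (simp add: exp_smax_def powr_diff)
  finally show ?thesis .
qed

lemma exp_smax2_le: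
  assumes "finite T" "t \<in> T" "s \<in> T"
  shows "exp_smax2 l \<beta> T t s z \<le> exp_smax l \<beta> T z"
proof -
  have S: "0 < sum_exp \<beta> T z" using assms by (intro sum_exp_pos) auto
  have "exp_smax2 l \<beta> T t s z \<le> sum_exp \<beta> T z * sum_exp \<beta> T z * sum_exp \<beta> T z powr (l / \<beta> - 2)"
    unfolding exp_smax2_def using assms S by (intro mult_right_mono mult_mono exp_le_sum_exp) auto
  also have "\<dots> = exp_smax l \<beta> T z" using S by (simp add: exp_smax_def powr_diff powr_numeral power2_eq_square)
  finally show ?thesis .
qed

lemma exp_smax_measurable [measurable]:
  assumes [measurable]: "\<And>t. t \<in> T \<Longrightarrow> (\<lambda>x. z x t) \<in> borel_measurable M"
  shows "(\<lambda>x. exp_smax l \<beta> T (z x)) \<in> borel_measurable M"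
  unfolding exp_smax_def sum_exp_def by measurable

lemma exp_smax1_measurable [measurable]:
  assumes [measurable]: "\<And>t. t \<in> T \<Longrightarrow> (\<lambda>x. z x t) \<in> borel_measurable M" "t \<in> T"
  shows "(\<lambda>x. exp_smax1 l \<beta> T t (z x)) \<in> borel_measurable M"
  unfolding exp_smax1_def sum_exp_def by measurable

lemma exp_smax2_measurable [measurable]:
  assumes [measurable]: "\<And>t. t \<in> T \<Longrightarrow> (\<lambda>x. z x t) \<in> borel_measurable M" "t \<in> T" "s \<in> T"
  shows "(\<lambda>x. exp_smax2 l \<beta> T t s (z x)) \<in> borel_measurable M"
  unfolding exp_smax2_def sum_exp_def by measurable

lemma exp_growth_sum_exp:
  assumes "finite I"
  shows "exp_growth I (\<lambda>\<xi>. 1 + sum_exp \<beta> T (\<lambda>t. linform I (w t) \<xi>))"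
  unfolding sum_exp_def linform_cmult[symmetric]
  by (intro exp_growth_add exp_growth_const exp_growth_sum exp_growth_exp_linform assms)

lemma exp_growth_exp_smaxI:
  assumes "finite I" "finite T" "T \<noteq> {}" "0 < l" "l < \<beta>"
    and H: "H \<in> borel_measurable (gaussian I)"
    and le: "\<And>\<xi>. 0 \<le> H \<xi>" "\<And>\<xi>. H \<xi> \<le> exp_smax l \<beta> T (\<lambda>t. linform I (w t) \<xi>)"
  shows "exp_growth I H"
proof (rule exp_growth_bound[OF exp_growth_sum_exp[OF assms(1), of \<beta> T w] H])
  fix \<xi>
  show "\<bar>H \<xi>\<bar> \<le> \<bar>1 + sum_exp \<beta> T (\<lambda>t. linform I (w t) \<xi>)\<bar>"
    using le[of \<xi>] exp_smax_le[OF assms(2-5), of "\<lambda>t. linform I (w t) \<xi>"] by linarith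
qed

section \<open>Gaussian comparison by interpolation\<close>

context
  fixes I :: "'i set" and T :: "'t set" and l \<beta> :: real
  assumes fin: "finite I" "finite T" "T \<noteq> {}" and l: "0 < l" "l < \<beta>"
begin

lemma exp_growth_exp_smax: "exp_growth I (\<lambda>\<xi>. exp_smax l \<beta> T (\<lambda>t. linform I (w t) \<xi>))"
  by (rule exp_growth_exp_smaxI[OF fin l, where w = w]) (simp_all add: exp_smax_nonneg)

lemma exp_growth_exp_smax1: "t \<in> T \<Longrightarrow> exp_growth I (\<lambda>\<xi>. exp_smax1 l \<beta> T t (\<lambda>t. linform I (w t) \<xi>))"
  by (rule exp_growth_exp_smaxI[OF fin l, where w = w]) (simp_all add: exp_smax1_nonneg exp_smax1_le fin)

lemma exp_growth_exp_smax2: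
  "t \<in> T \<Longrightarrow> s \<in> T \<Longrightarrow> exp_growth I (\<lambda>\<xi>. exp_smax2 l \<beta> T t s (\<lambda>t. linform I (w t) \<xi>))"
  by (rule exp_growth_exp_smaxI[OF fin l, where w = w]) (simp_all add: exp_smax2_nonneg exp_smax2_le fin)

lemma exp_smax1_stein:
  assumes k: "k \<in> I" and t: "t \<in> T"
  shows "(\<integral>\<xi>. \<xi> k * exp_smax1 l \<beta> T t (\<lambda>t. linform I (w t) \<xi>) \<partial>gaussian I) =
     \<beta> * w t k * (\<integral>\<xi>. exp_smax1 l \<beta> T t (\<lambda>t. linform I (w t) \<xi>) \<partial>gaussian I) -
     (\<beta> - l) * (\<Sum>s\<in>T. w s k * (\<integral>\<xi>. exp_smax2 l \<beta> T t s (\<lambda>t. linform I (w t) \<xi>) \<partial>gaussian I))"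
proof -
  let ?z = "\<lambda>\<xi> t. linform I (w t) \<xi>"
  let ?H' = "\<lambda>\<xi>. \<beta> * w t k * exp_smax1 l \<beta> T t (?z \<xi>) - (\<beta> - l) * (\<Sum>s\<in>T. w s k * exp_smax2 l \<beta> T t s (?z \<xi>))"
  have \<beta>: "0 < \<beta>" using l by simp
  have int: "integrable (gaussian I) (\<lambda>\<xi>. exp_smax1 l \<beta> T t (?z \<xi>))"
     "\<And>s. s \<in> T \<Longrightarrow> integrable (gaussian I) (\<lambda>\<xi>. exp_smax2 l \<beta> T t s (?z \<xi>))"
    using t by (auto intro!: exp_growth_integrable fin exp_growth_exp_smax1 exp_growth_exp_smax2)
  have "(\<integral>\<xi>. \<xi> k * exp_smax1 l \<beta> T t (?z \<xi>) \<partial>gaussian I) = (\<integral>\<xi>. ?H' \<xi> \<partial>gaussian I)"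
  proof (rule gaussian_stein[OF fin(1) k])
    show "exp_growth I (\<lambda>\<xi>. exp_smax1 l \<beta> T t (?z \<xi>))" by (rule exp_growth_exp_smax1[OF t])
    show "exp_growth I ?H'"
      by (intro exp_growth_diff exp_growth_mult exp_growth_const exp_growth_sum exp_growth_exp_smax1 exp_growth_exp_smax2 t)
    show "((\<lambda>y. exp_smax1 l \<beta> T t (?z (\<xi>(k := y)))) has_real_derivative ?H' (\<xi>(k := x))) (at x)" for \<xi> x
      by (rule exp_smax1_deriv[OF fin(2,3) \<beta> t]) (rule linform_deriv[OF fin(1) k])
    have z: "isCont (\<lambda>y. linform I v (\<xi>(k := y))) x" for v x \<xi>
      using linform_deriv[OF fin(1) k] by (rule DERIV_isCont)
    show "isCont (\<lambda>y. ?H' (\<xi>(k := y))) x" for \<xi> x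
      unfolding exp_smax1_def exp_smax2_def sum_exp_def
      using sum_exp_pos[OF fin(2,3), unfolded sum_exp_def]
      by (intro continuous_intros z) (auto simp: less_imp_neq[THEN not_sym])
  qed
  also have "\<dots> = \<beta> * w t k * (\<integral>\<xi>. exp_smax1 l \<beta> T t (?z \<xi>) \<partial>gaussian I) -
     (\<beta> - l) * (\<Sum>s\<in>T. w s k * (\<integral>\<xi>. exp_smax2 l \<beta> T t s (?z \<xi>) \<partial>gaussian I))"
    using int by (subst Bochner_Integration.integral_diff)
      (auto simp: Bochner_Integration.integral_sum intro!: integrable_mult_right Bochner_Integration.integrable_sum)
  finally show ?thesis .
qed

text \<open>
Stein's identity replaces the linear form with weights \<open>v t\<close> by derivatives of \<open>exp_smax1\<close>. The second
derivative in direction \<open>t, t\<close> has a part of the wrong sign; it is multiplied by \<open>\<langle>v t, w t\<rangle>\<close>, and the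
first assumption removes it. What is left is \<open>- (\<beta> - l)\<close> times a sum of products of nonnegative numbers.
\<close>

lemma exp_smax_path_derivative_nonpos:
  assumes var: "\<And>t. t \<in> T \<Longrightarrow> (\<Sum>k\<in>I. v t k * w t k) = 0"
    and cov: "\<And>t s. t \<in> T \<Longrightarrow> s \<in> T \<Longrightarrow> 0 \<le> (\<Sum>k\<in>I. v t k * w s k)"
  shows "(\<integral>\<xi>. (\<Sum>t\<in>T. linform I (v t) \<xi> * exp_smax1 l \<beta> T t (\<lambda>t. linform I (w t) \<xi>)) \<partial>gaussian I) \<le> 0"
proof -
  let ?z = "\<lambda>\<xi> t. linform I (w t) \<xi>"
  let ?E1 = "\<lambda>t. (\<integral>\<xi>. exp_smax1 l \<beta> T t (?z \<xi>) \<partial>gaussian I)"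
  let ?E2 = "\<lambda>t s. (\<integral>\<xi>. exp_smax2 l \<beta> T t s (?z \<xi>) \<partial>gaussian I)"
  have int: "integrable (gaussian I) (\<lambda>\<xi>. \<xi> k * exp_smax1 l \<beta> T t (?z \<xi>))" if "k \<in> I" "t \<in> T" for k t
    using that by (intro exp_growth_integrable fin exp_growth_mult exp_growth_component exp_growth_exp_smax1)
  have "(\<integral>\<xi>. (\<Sum>t\<in>T. linform I (v t) \<xi> * exp_smax1 l \<beta> T t (?z \<xi>)) \<partial>gaussian I)
      = (\<integral>\<xi>. (\<Sum>t\<in>T. \<Sum>k\<in>I. v t k * (\<xi> k * exp_smax1 l \<beta> T t (?z \<xi>))) \<partial>gaussian I)"
    unfolding linform_def[of I "v _"] by (simp add: sum_distrib_right mult_ac)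
  also have "\<dots> = (\<Sum>t\<in>T. \<Sum>k\<in>I. v t k * (\<integral>\<xi>. \<xi> k * exp_smax1 l \<beta> T t (?z \<xi>) \<partial>gaussian I))"
    using int by (simp add: Bochner_Integration.integral_sum)
  also have "\<dots> = (\<Sum>t\<in>T. \<Sum>k\<in>I. v t k * (\<beta> * w t k * ?E1 t - (\<beta> - l) * (\<Sum>s\<in>T. w s k * ?E2 t s)))"
    by (intro sum.cong refl arg_cong2[where f = "(*)"] exp_smax1_stein)
  also have "\<dots> = (\<Sum>t\<in>T. \<beta> * ?E1 t * (\<Sum>k\<in>I. v t k * w t k) - (\<beta> - l) * (\<Sum>s\<in>T. (\<Sum>k\<in>I. v t k * w s k) * ?E2 t s))"
  proof (rule sum.cong[OF refl])
    fix t
    have "(\<Sum>k\<in>I. v t k * (\<Sum>s\<in>T. w s k * ?E2 t s)) = (\<Sum>s\<in>T. (\<Sum>k\<in>I. v t k * w s k) * ?E2 t s)"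
      unfolding sum_distrib_left sum_distrib_right by (subst sum.swap) (simp add: mult_ac)
    moreover have "(\<Sum>k\<in>I. v t k * (\<beta> * w t k * ?E1 t - (\<beta> - l) * R k))
       = \<beta> * ?E1 t * (\<Sum>k\<in>I. v t k * w t k) - (\<beta> - l) * (\<Sum>k\<in>I. v t k * R k)" for R
      unfolding sum_distrib_left sum_subtractf[symmetric] by (intro sum.cong refl) (simp add: algebra_simps)
    ultimately show "(\<Sum>k\<in>I. v t k * (\<beta> * w t k * ?E1 t - (\<beta> - l) * (\<Sum>s\<in>T. w s k * ?E2 t s)))
       = \<beta> * ?E1 t * (\<Sum>k\<in>I. v t k * w t k) - (\<beta> - l) * (\<Sum>s\<in>T. (\<Sum>k\<in>I. v t k * w s k) * ?E2 t s)"
      by simp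
  qed
  also have "\<dots> = - ((\<beta> - l) * (\<Sum>t\<in>T. \<Sum>s\<in>T. (\<Sum>k\<in>I. v t k * w s k) * ?E2 t s))"
    using var by (simp add: sum_negf sum_distrib_left)
  also have "\<dots> \<le> 0"
  proof -
    have "0 \<le> (\<Sum>t\<in>T. \<Sum>s\<in>T. (\<Sum>k\<in>I. v t k * w s k) * ?E2 t s)"
      by (intro sum_nonneg mult_nonneg_nonneg cov integral_nonneg_AE AE_I2 exp_smax2_nonneg)
    then show ?thesis using l by (simp add: mult_nonneg_nonneg)
  qed
  finally show ?thesis .
qed

text \<open>
The two processes \<open>X\<^sub>t\<close>, \<open>Y\<^sub>t\<close> with weights \<open>a t\<close>, \<open>b t\<close> live on the same Gaussian vector; the orthogonality
assumption makes them independent. The path \<open>sin \<theta> X + cos \<theta> Y\<close> leads from \<open>Y\<close> to \<open>X\<close>. Its velocity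
and position have the covariances \<open>sin \<theta> cos \<theta> (\<langle>a t, a s\<rangle> - \<langle>b t, b s\<rangle>)\<close>, which are
nonnegative and vanish for \<open>s = t\<close>, so that the expectation decreases along the path. Integrating
the pointwise derivative and exchanging the integrals avoids differentiating under the expectation.
\<close>

theorem gaussian_comparison:
  fixes a b :: "'t \<Rightarrow> 'i \<Rightarrow> real"
  assumes var: "\<And>t. t \<in> T \<Longrightarrow> (\<Sum>k\<in>I. a t k * a t k) = (\<Sum>k\<in>I. b t k * b t k)"
    and cov: "\<And>t s. t \<in> T \<Longrightarrow> s \<in> T \<Longrightarrow> (\<Sum>k\<in>I. b t k * b s k) \<le> (\<Sum>k\<in>I. a t k * a s k)"
    and orth: "\<And>t s. t \<in> T \<Longrightarrow> s \<in> T \<Longrightarrow> (\<Sum>k\<in>I. a t k * b s k) = 0"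
  shows "(\<integral>\<xi>. exp_smax l \<beta> T (\<lambda>t. linform I (a t) \<xi>) \<partial>gaussian I)
       \<le> (\<integral>\<xi>. exp_smax l \<beta> T (\<lambda>t. linform I (b t) \<xi>) \<partial>gaussian I)"
proof -
  define w where "w \<theta> t k = sin \<theta> * a t k + cos \<theta> * b t k" for \<theta> t k
  define v where "v \<theta> t k = cos \<theta> * a t k - sin \<theta> * b t k" for \<theta> t k
  have lw: "linform I (w \<theta> t) \<xi> = sin \<theta> * linform I (a t) \<xi> + cos \<theta> * linform I (b t) \<xi>" for \<theta> t \<xi>
    unfolding linform_def w_def by (simp add: sum_distrib_left sum.distrib algebra_simps)
  have lv: "linform I (v \<theta> t) \<xi> = cos \<theta> * linform I (a t) \<xi> - sin \<theta> * linform I (b t) \<xi>" for \<theta> t \<xi>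
    unfolding linform_def v_def by (simp add: sum_distrib_left sum_subtractf algebra_simps)
  have inner: "(\<Sum>k\<in>I. v \<theta> t k * w \<theta> s k) =
      sin \<theta> * cos \<theta> * ((\<Sum>k\<in>I. a t k * a s k) - (\<Sum>k\<in>I. b t k * b s k))" if "t \<in> T" "s \<in> T" for \<theta> t s
  proof -
    have "(\<Sum>k\<in>I. v \<theta> t k * w \<theta> s k) =
       sin \<theta> * cos \<theta> * (\<Sum>k\<in>I. a t k * a s k) + (cos \<theta>)\<^sup>2 * (\<Sum>k\<in>I. a t k * b s k)
       - (sin \<theta>)\<^sup>2 * (\<Sum>k\<in>I. a s k * b t k) - sin \<theta> * cos \<theta> * (\<Sum>k\<in>I. b t k * b s k)"
      unfolding v_def w_def sum_distrib_left sum.distrib[symmetric] sum_subtractf[symmetric]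
      by (intro sum.cong refl) (simp add: algebra_simps power2_eq_square)
    then show ?thesis using orth that by (simp add: algebra_simps)
  qed
  define F where "F \<theta> \<xi> = exp_smax l \<beta> T (\<lambda>t. linform I (w \<theta> t) \<xi>)" for \<theta> \<xi>
  define D where "D \<theta> \<xi> = l * (\<Sum>t\<in>T. linform I (v \<theta> t) \<xi> * exp_smax1 l \<beta> T t (\<lambda>t. linform I (w \<theta> t) \<xi>))" for \<theta> \<xi>
  have deriv: "((\<lambda>\<theta>. F \<theta> \<xi>) has_real_derivative D \<theta> \<xi>) (at \<theta>)" for \<theta> \<xi>
    unfolding F_def D_def
  proof (rule exp_smax_deriv[OF fin(2,3)])
    show "((\<lambda>\<theta>. linform I (w \<theta> t) \<xi>) has_real_derivative linform I (v \<theta> t) \<xi>) (at \<theta>)" for t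
      unfolding lw lv by (auto intro!: derivative_eq_intros)
  qed (use l in auto)
  have cont: "isCont (\<lambda>\<theta>. D \<theta> \<xi>) \<theta>" for \<theta> \<xi>
    unfolding D_def lv lw exp_smax1_def sum_exp_def
    using sum_exp_pos[OF fin(2,3), unfolded sum_exp_def]
    by (intro continuous_intros) (auto simp: less_imp_neq[THEN not_sym])
  let ?Q = "{0..pi/2}"
  let ?g = "\<lambda>\<xi> \<theta>. D \<theta> \<xi> * indicator ?Q \<theta>"
  have FTC: "(\<integral>\<theta>. ?g \<xi> \<theta> \<partial>lborel) = F (pi/2) \<xi> - F 0 \<xi>" for \<xi>
    by (rule integral_FTC_Icc_real) (auto intro: deriv cont)
  have meas: "(\<lambda>(\<xi>, \<theta>). ?g \<xi> \<theta>) \<in> borel_measurable (gaussian I \<Otimes>\<^sub>M lborel)"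
    unfolding D_def lv lw by measurable
  interpret pair_sigma_finite "gaussian I" lborel
    by (intro pair_sigma_finite.intro gaussian_prob.sigma_finite_measure lborel.sigma_finite_measure_axioms)
  \<comment> \<open>A bound for the derivative that is uniform along the path, as needed for Fubini's theorem.\<close>
  obtain K where K: "exp_growth I K" "\<And>\<theta> \<xi>. \<bar>D \<theta> \<xi>\<bar> \<le> K \<xi>"
  proof
    let ?K1 = "\<lambda>t \<xi>. \<bar>linform I (a t) \<xi>\<bar> + \<bar>linform I (b t) \<xi>\<bar>"
    let ?K = "\<lambda>\<xi>. l * (\<Sum>t\<in>T. ?K1 t \<xi> * (1 + (\<Sum>s\<in>T. exp (\<beta> * ?K1 s \<xi>))))"
    have abs: "exp_growth I (\<lambda>\<xi>. \<bar>linform I u \<xi>\<bar>)" for u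
      by (rule exp_growth_bound[OF exp_growth_linform[OF fin(1), of u]]) auto
    have eabs: "exp_growth I (\<lambda>\<xi>. exp (\<beta> * \<bar>linform I u \<xi>\<bar>))" for u
    proof (rule exp_growth_bound)
      show "exp_growth I (\<lambda>\<xi>. exp (linform I (\<lambda>k. \<beta> * u k) \<xi>) + exp (linform I (\<lambda>k. - \<beta> * u k) \<xi>))"
        by (intro exp_growth_add exp_growth_exp_linform fin)
      show "\<bar>exp (\<beta> * \<bar>linform I u \<xi>\<bar>)\<bar> \<le> \<bar>exp (linform I (\<lambda>k. \<beta> * u k) \<xi>) + exp (linform I (\<lambda>k. - \<beta> * u k) \<xi>)\<bar>" for \<xi>
        unfolding linform_cmult by (cases "0 \<le> linform I u \<xi>") auto
    qed measurable
    show "exp_growth I ?K"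
      unfolding distrib_left[of \<beta>] exp_add
      by (intro exp_growth_mult exp_growth_const exp_growth_sum exp_growth_add abs eabs)
    show "\<bar>D \<theta> \<xi>\<bar> \<le> ?K \<xi>" for \<theta> \<xi>
    proof -
      have sc: "\<bar>sin \<theta> * x\<bar> \<le> \<bar>x\<bar>" "\<bar>cos \<theta> * x\<bar> \<le> \<bar>x\<bar>" for x :: real
        by (auto simp: abs_mult intro!: mult_left_le_one_le)
      have w_le: "linform I (w \<theta> t) \<xi> \<le> ?K1 t \<xi>" for t
        unfolding lw using sc(1)[of "linform I (a t) \<xi>"] sc(2)[of "linform I (b t) \<xi>"] by linarith
      have v_le: "\<bar>linform I (v \<theta> t) \<xi>\<bar> \<le> ?K1 t \<xi>" for t
        unfolding lv using sc(2)[of "linform I (a t) \<xi>"] sc(1)[of "linform I (b t) \<xi>"] by linarith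
      have "exp_smax1 l \<beta> T t (\<lambda>t. linform I (w \<theta> t) \<xi>) \<le> 1 + (\<Sum>s\<in>T. exp (\<beta> * ?K1 s \<xi>))" if "t \<in> T" for t
      proof -
        have "exp_smax1 l \<beta> T t (\<lambda>t. linform I (w \<theta> t) \<xi>) \<le> 1 + sum_exp \<beta> T (\<lambda>t. linform I (w \<theta> t) \<xi>)"
          using exp_smax1_le[OF fin(2) that] exp_smax_le[OF fin(2,3) l] by (rule order.trans)
        also have "\<dots> \<le> 1 + (\<Sum>s\<in>T. exp (\<beta> * ?K1 s \<xi>))"
          unfolding sum_exp_def using w_le l by (intro add_left_mono sum_mono) (auto intro!: mult_left_mono)
        finally show ?thesis .
      qed
      then have "(\<Sum>t\<in>T. \<bar>linform I (v \<theta> t) \<xi> * exp_smax1 l \<beta> T t (\<lambda>t. linform I (w \<theta> t) \<xi>)\<bar>)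
          \<le> (\<Sum>t\<in>T. ?K1 t \<xi> * (1 + (\<Sum>s\<in>T. exp (\<beta> * ?K1 s \<xi>))))"
        unfolding abs_mult abs_of_nonneg[OF exp_smax1_nonneg]
        by (intro sum_mono mult_mono v_le exp_smax1_nonneg) auto
      then have "\<bar>\<Sum>t\<in>T. linform I (v \<theta> t) \<xi> * exp_smax1 l \<beta> T t (\<lambda>t. linform I (w \<theta> t) \<xi>)\<bar>
          \<le> (\<Sum>t\<in>T. ?K1 t \<xi> * (1 + (\<Sum>s\<in>T. exp (\<beta> * ?K1 s \<xi>))))"
        by (rule order.trans[OF sum_abs])
      then show ?thesis
        unfolding D_def abs_mult[of l] abs_of_pos[OF l(1)] using l by (intro mult_left_mono) auto
    qed
  qed
  have int: "integrable (gaussian I \<Otimes>\<^sub>M lborel) (\<lambda>(\<xi>, \<theta>). ?g \<xi> \<theta>)"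
  proof (rule Bochner_Integration.integrable_bound[OF _ meas])
    note [measurable] = exp_growth_measurable[OF K(1)]
    show "integrable (gaussian I \<Otimes>\<^sub>M lborel) (\<lambda>(\<xi>, \<theta>). K \<xi> * indicator ?Q \<theta>)"
    proof (rule Fubini_integrable)
      show "integrable (gaussian I) (\<lambda>\<xi>. \<integral>\<theta>. norm (case (\<xi>, \<theta>) of (\<xi>, \<theta>) \<Rightarrow> K \<xi> * indicator ?Q \<theta>) \<partial>lborel)"
        using exp_growth_integrable[OF fin(1) K(1)] by (simp add: abs_mult)
    qed auto
    show "AE x in gaussian I \<Otimes>\<^sub>M lborel. norm (case x of (\<xi>, \<theta>) \<Rightarrow> ?g \<xi> \<theta>) \<le> norm (case x of (\<xi>, \<theta>) \<Rightarrow> K \<xi> * indicator ?Q \<theta>)"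
      using order.trans[OF K(2) abs_ge_self] by (auto intro!: AE_I2 simp: indicator_def)
  qed
  have intF: "integrable (gaussian I) (F \<theta>)" for \<theta>
    unfolding F_def by (intro exp_growth_integrable exp_growth_exp_smax fin)
  have "(\<integral>\<xi>. F (pi/2) \<xi> \<partial>gaussian I) - (\<integral>\<xi>. F 0 \<xi> \<partial>gaussian I)
      = (\<integral>\<xi>. (\<integral>\<theta>. ?g \<xi> \<theta> \<partial>lborel) \<partial>gaussian I)"
    unfolding FTC by (simp add: Bochner_Integration.integral_diff intF)
  also have "\<dots> = (\<integral>\<theta>. (\<integral>\<xi>. ?g \<xi> \<theta> \<partial>gaussian I) \<partial>lborel)"
    using Fubini_integral[OF int] by simp
  also have "\<dots> \<le> 0"
  proof -
    have "(\<integral>\<xi>. ?g \<xi> \<theta> \<partial>gaussian I) \<le> 0" for \<theta>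
    proof (cases "\<theta> \<in> ?Q")
      case True
      then have sc: "0 \<le> sin \<theta> * cos \<theta>" by (auto intro!: mult_nonneg_nonneg sin_ge_zero cos_ge_zero)
      have "(\<integral>\<xi>. (\<Sum>t\<in>T. linform I (v \<theta> t) \<xi> * exp_smax1 l \<beta> T t (\<lambda>t. linform I (w \<theta> t) \<xi>)) \<partial>gaussian I) \<le> 0"
        by (rule exp_smax_path_derivative_nonpos) (use inner var cov sc in auto)
      then show ?thesis using l by (simp add: D_def mult_nonneg_nonpos indicator_simps(1)[OF True])
    qed simp
    then have "0 \<le> (\<integral>\<theta>. - (\<integral>\<xi>. ?g \<xi> \<theta> \<partial>gaussian I) \<partial>lborel)"
      by (intro integral_nonneg_AE AE_I2) simp
    then show ?thesis by simp
  qed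
  finally show ?thesis by (simp add: F_def lw)
qed

end

section \<open>Tail bound for the norm of a Gaussian matrix\<close>

lemma gaussian_integral_restrict:
  fixes h :: "('i \<Rightarrow> real) \<Rightarrow> real"
  assumes "finite K" "K \<subseteq> I" "h \<in> borel_measurable (gaussian K)"
    and h: "\<And>\<xi>. h (restrict \<xi> K) = h \<xi>"
  shows "(\<integral>\<xi>. h \<xi> \<partial>gaussian I) = (\<integral>\<xi>. h \<xi> \<partial>gaussian K)"
proof -
  have *: "distr (gaussian I) (gaussian K) (\<lambda>\<xi>. restrict \<xi> K) = gaussian K"
    unfolding gaussian_def using gaussian.distr_PiM_restrict_finite[OF assms(1,2)] by simp
  have "(\<integral>\<xi>. h \<xi> \<partial>gaussian K) = (\<integral>\<xi>. h \<xi> \<partial>distr (gaussian I) (gaussian K) (\<lambda>\<xi>. restrict \<xi> K))"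
    by (simp only: *)
  also have "\<dots> = (\<integral>\<xi>. h (restrict \<xi> K) \<partial>gaussian I)"
    using assms(2,3) by (intro integral_distr) (auto simp: gaussian_def intro!: measurable_restrict_subset)
  finally show ?thesis by (simp add: h)
qed

definition bilin :: "nat \<Rightarrow> (nat \<Rightarrow> real) \<Rightarrow> (nat \<Rightarrow> real) \<Rightarrow> (nat \<times> nat \<Rightarrow> real) \<Rightarrow> real" where
  "bilin n u v \<xi> = (\<Sum>i<n. \<Sum>j<n. u i * v j * \<xi> (i, j))"

abbreviation "square n \<equiv> {..<n} \<times> {..<n::nat}"

lemma bilin_eq_linform: "bilin n u v = linform (square n) (\<lambda>(i, j). u i * v j)"
  unfolding bilin_def linform_def by (simp add: sum.cartesian_product fun_eq_iff case_prod_unfold)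

text \<open>
An \<open>n + 1\<close> by \<open>n + 1\<close> array splits into the \<open>n\<close> by \<open>n\<close> block, its bordering column and row, and the corner.
This supplies all Gaussian variables of the comparison: the matrix \<open>G\<close>, the vectors \<open>g\<close> and \<open>h\<close>, and
the additional variable \<open>z\<close>.
\<close>

lemma sum_square_Suc:
  "(\<Sum>k\<in>square (Suc n). h k) =
     (\<Sum>i<n. \<Sum>j<n. h (i, j)) + (\<Sum>i<n. h (i, n)) + (\<Sum>j<n. h (n, j)) + (h (n, n) :: real)"
proof -
  have "(\<Sum>k\<in>square (Suc n). h k) = (\<Sum>i<Suc n. \<Sum>j<Suc n. h (i, j))"
    unfolding sum.cartesian_product by (simp add: case_prod_unfold)
  also have "\<dots> = (\<Sum>i<n. (\<Sum>j<n. h (i, j)) + h (i, n)) + ((\<Sum>j<n. h (n, j)) + h (n, n))"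
    by simp
  finally show ?thesis by (simp add: sum.distrib)
qed

lemma exp_smax_le_card:
  assumes "finite T" "0 < l" "0 < \<beta>" and z: "\<And>t. t \<in> T \<Longrightarrow> z t \<le> m"
  shows "exp_smax l \<beta> T z \<le> real (card T) powr (l / \<beta>) * exp (l * m)"
proof -
  have "sum_exp \<beta> T z \<le> real (card T) * exp (\<beta> * m)"
    unfolding sum_exp_def using assms by (intro sum_bounded_above) auto
  then have "exp_smax l \<beta> T z \<le> (real (card T) * exp (\<beta> * m)) powr (l / \<beta>)"
    unfolding exp_smax_def using assms
    by (intro powr_mono2) (auto simp: sum_exp_def intro!: sum_nonneg)
  also have "\<dots> = real (card T) powr (l / \<beta>) * exp (l * m)"
    using assms by (simp add: powr_mult powr_def[of "exp _"])
  finally show ?thesis .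
qed

lemma exp_le_exp_smax:
  assumes "finite T" "0 < l" "0 < \<beta>" "t \<in> T"
  shows "exp (l * z t) \<le> exp_smax l \<beta> T z"
proof -
  have "exp (l * z t) = exp (\<beta> * z t) powr (l / \<beta>)" using assms by (simp add: powr_def)
  also have "\<dots> \<le> exp_smax l \<beta> T z"
    unfolding exp_smax_def using assms by (intro powr_mono2 exp_le_sum_exp) auto
  finally show ?thesis .
qed

lemma exp_smax_shift:
  assumes "0 < \<beta>"
  shows "exp_smax l \<beta> T (\<lambda>t. z t + y) = exp_smax l \<beta> T z * exp (l * y)"
proof -
  have "sum_exp \<beta> T (\<lambda>t. z t + y) = sum_exp \<beta> T z * exp (\<beta> * y)"
    unfolding sum_exp_def by (simp add: sum_distrib_right distrib_left exp_add)
  then show ?thesis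
    unfolding exp_smax_def using assms by (simp add: powr_mult sum_exp_def sum_nonneg powr_def[of "exp _"])
qed

text \<open>
The weights of \<open>u\<^sup>T G v + z\<close>, with \<open>z\<close> the corner variable.
\<close>

definition matrix_weights :: "nat \<Rightarrow> (nat \<Rightarrow> real) \<times> (nat \<Rightarrow> real) \<Rightarrow> nat \<times> nat \<Rightarrow> real" where
  "matrix_weights n = (\<lambda>(u, v) (i, j). if i < n \<and> j < n then u i * v j else if i = n \<and> j = n then 1 else 0)"

text \<open>
The weights of \<open>g\<^sup>T u + h\<^sup>T v\<close>, with \<open>g\<close> the bordering column and \<open>h\<close> the bordering row.
\<close>

definition border_weights :: "nat \<Rightarrow> (nat \<Rightarrow> real) \<times> (nat \<Rightarrow> real) \<Rightarrow> nat \<times> nat \<Rightarrow> real" where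
  "border_weights n = (\<lambda>(u, v) (i, j). if i < n \<and> j = n then u i else if i = n \<and> j < n then v j else 0)"

lemma inner_matrix_weights:
  "(\<Sum>k\<in>square (Suc n). matrix_weights n (u, v) k * matrix_weights n (u', v') k)
   = (\<Sum>i<n. u i * u' i) * (\<Sum>j<n. v j * v' j) + 1"
  unfolding sum_square_Suc by (simp add: matrix_weights_def sum_product mult_ac)

lemma inner_border_weights:
  "(\<Sum>k\<in>square (Suc n). border_weights n (u, v) k * border_weights n (u', v') k)
   = (\<Sum>i<n. u i * u' i) + (\<Sum>j<n. v j * v' j)"
  unfolding sum_square_Suc by (simp add: border_weights_def)

lemma inner_matrix_border_weights: "(\<Sum>k\<in>square (Suc n). matrix_weights n t k * border_weights n s k) = 0"
  unfolding sum_square_Suc by (simp add: matrix_weights_def border_weights_def split: prod.splits)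

lemma linform_matrix_weights: "linform (square (Suc n)) (matrix_weights n (u, v)) \<xi> = bilin n u v \<xi> + \<xi> (n, n)"
  unfolding linform_def sum_square_Suc by (simp add: matrix_weights_def bilin_def)

lemma linform_border_weights:
  "linform (square (Suc n)) (border_weights n (u, v)) \<xi> = (\<Sum>i<n. u i * \<xi> (i, n)) + (\<Sum>j<n. v j * \<xi> (n, j))"
  unfolding linform_def sum_square_Suc by (simp add: border_weights_def)

lemma inner_le_one:
  fixes u v :: "nat \<Rightarrow> real"
  assumes "(\<Sum>i<n. (u i)\<^sup>2) = 1" "(\<Sum>i<n. (v i)\<^sup>2) = 1"
  shows "(\<Sum>i<n. u i * v i) \<le> 1"
proof -
  have "(\<Sum>i<n. u i * v i) \<le> (\<Sum>i<n. ((u i)\<^sup>2 + (v i)\<^sup>2) / 2)"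
  proof (rule sum_mono)
    fix i show "u i * v i \<le> ((u i)\<^sup>2 + (v i)\<^sup>2) / 2"
      using sum_squares_bound[of "u i" "v i"] by simp
  qed
  also have "\<dots> = 1" using assms by (simp add: sum_divide_distrib[symmetric] sum.distrib)
  finally show ?thesis .
qed

text \<open>
Cauchy-Schwarz and \<open>|x| \<le> A / 2 + |x|\<^sup>2 / (2 A)\<close> in one step. The right-hand side is a sum over the
coordinates, so its exponential moments factorize.
\<close>

lemma unit_inner_le:
  fixes u x :: "nat \<Rightarrow> real"
  assumes "(\<Sum>i<n. (u i)\<^sup>2) = 1" "0 < A"
  shows "(\<Sum>i<n. u i * x i) \<le> A / 2 + (\<Sum>i<n. (x i)\<^sup>2) / (2 * A)"
proof -
  have "(\<Sum>i<n. u i * x i) \<le> (\<Sum>i<n. A / 2 * (u i)\<^sup>2 + (x i)\<^sup>2 / (2 * A))"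
  proof (rule sum_mono)
    fix i
    have "0 \<le> (A * u i - x i)\<^sup>2 / (2 * A)" using assms by simp
    also have "(A * u i - x i)\<^sup>2 / (2 * A) = A / 2 * (u i)\<^sup>2 + (x i)\<^sup>2 / (2 * A) - u i * x i"
      using assms by (simp add: field_simps power2_eq_square)
    finally show "u i * x i \<le> A / 2 * (u i)\<^sup>2 + (x i)\<^sup>2 / (2 * A)" by simp
  qed
  also have "\<dots> = A / 2 * (\<Sum>i<n. (u i)\<^sup>2) + (\<Sum>i<n. (x i)\<^sup>2) / (2 * A)"
    by (simp add: sum.distrib sum_distrib_left sum_divide_distrib)
  finally show ?thesis using assms by simp
qed

lemma gaussian_exp_squares:
  assumes "finite I" "K \<subseteq> I" "0 \<le> s" "s < 1"
  shows "has_bochner_integral (gaussian I) (\<lambda>\<xi>. exp (s / 2 * (\<Sum>k\<in>K. (\<xi> k)\<^sup>2))) ((1 / sqrt (1 - s)) ^ card K)"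
proof -
  let ?f = "\<lambda>k x. if k \<in> K then exp (s * x\<^sup>2 / 2) else 1 :: real"
  have K: "finite K" using assms(1,2) by (rule finite_subset[rotated])
  have eq: "exp (s / 2 * (\<Sum>k\<in>K. (\<xi> k)\<^sup>2)) = (\<Prod>k\<in>I. ?f k (\<xi> k))" for \<xi> :: "'a \<Rightarrow> real"
    using K assms(1,2) by (simp add: prod.inter_restrict[symmetric] Int_absorb1 sum_distrib_left exp_sum)
  have int: "has_bochner_integral std_gaussian (?f k) (if k \<in> K then 1 / sqrt (1 - s) else 1)" for k
    using std_gaussian_exp_square[OF assms(4)] std_gaussian.prob_space
    by (auto simp: has_bochner_integral_iff)
  then have "integrable (gaussian I) (\<lambda>\<xi>. \<Prod>k\<in>I. ?f k (\<xi> k))"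
    unfolding gaussian_def
    by (intro gaussian.product_integrable_prod assms(1)) (auto simp only: has_bochner_integral_iff)
  moreover have "(\<integral>\<xi>. (\<Prod>k\<in>I. ?f k (\<xi> k)) \<partial>gaussian I) = (\<Prod>k\<in>I. if k \<in> K then 1 / sqrt (1 - s) else 1)"
    unfolding gaussian_def using int
    by (subst gaussian.product_integral_prod[OF assms(1)]) (auto simp only: has_bochner_integral_iff)
  moreover have "(\<Prod>k\<in>I. if k \<in> K then 1 / sqrt (1 - s) else 1) = (1 / sqrt (1 - s)) ^ card K"
    using assms(1,2) by (simp add: prod.inter_restrict[symmetric] Int_absorb1)
  ultimately show ?thesis
    unfolding eq by (simp add: has_bochner_integral_iff)
qed

text \<open>
The left-hand side bounds \<open>E exp (l (|g| + |h|))\<close>, and this choice of \<open>A\<close> is the one for which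
\<open>1 / (1 - l / A) = 1 + l / sqrt n \<le> exp (l / sqrt n)\<close> makes both factors combine to the exponent on
the right.
\<close>

lemma chernoff_constant_bound:
  fixes l :: real
  assumes "0 < l" "0 < n" defines "A \<equiv> l + sqrt (real n)"
  shows "exp (l * A) * (1 / sqrt (1 - l / A)) ^ (2 * n) \<le> exp (2 * l * sqrt (real n) + l\<^sup>2)"
proof -
  let ?r = "sqrt (real n)"
  have r: "0 < ?r" "?r * ?r = real n" using assms by auto
  have A0: "0 < A" "l < A" using r \<open>0 < l\<close> unfolding A_def by linarith+
  then have A: "0 < A" "0 < 1 - l / A" by auto
  have "1 - l / A = ?r / A" using A0 by (simp add: A_def diff_divide_eq_iff)
  then have "1 / (1 - l / A) = 1 + l / ?r" using A0 r by (simp add: A_def add_divide_distrib)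
  also have "\<dots> \<le> exp (l / ?r)" by (rule exp_ge_add_one_self)
  finally have le: "1 / (1 - l / A) \<le> exp (l / ?r)" .
  have "(1 / sqrt (1 - l / A)) ^ (2 * n) = (1 / (1 - l / A)) ^ n"
    using A by (simp add: power_mult power_divide)
  also have "\<dots> \<le> exp (l / ?r) ^ n" using le A by (intro power_mono) auto
  also have "\<dots> = exp (l * ?r)"
    unfolding exp_of_nat_mult[symmetric] using r by (simp add: field_simps)
  finally have "exp (l * A) * (1 / sqrt (1 - l / A)) ^ (2 * n) \<le> exp (l * A) * exp (l * ?r)" by simp
  also have "\<dots> = exp (2 * l * ?r + l\<^sup>2)"
    unfolding exp_add[symmetric] by (simp add: A_def algebra_simps power2_eq_square)
  finally show ?thesis .
qed

lemma bilin_restrict: "bilin n u v (restrict \<xi> (square n)) = bilin n u v \<xi>"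
  unfolding bilin_def by (auto intro!: sum.cong)

lemma bilin_measurable [measurable]: "bilin n u v \<in> borel_measurable (gaussian (square n))"
  unfolding bilin_eq_linform by measurable

text \<open>
The comparison theorem, applied to \<open>u\<^sup>T G v + z\<close> and \<open>g\<^sup>T u + h\<^sup>T v\<close>. The variable \<open>z\<close> equalizes the
variances; being independent of \<open>G\<close>, it contributes the factor \<open>exp (l\<^sup>2 / 2)\<close> on the left, which
reduces the exponent \<open>l\<^sup>2\<close> on the right to \<open>l\<^sup>2 / 2\<close>. Without this gain the tail bound would have
exponent \<open>- \<epsilon>\<^sup>2 / 4\<close>.
\<close>

lemma gaussian_exp_smax_bilin:
  assumes T: "finite T" "T \<noteq> {}" and l: "0 < l" "l < \<beta>" and n: "0 < n"
    and unit: "\<And>u v. (u, v) \<in> T \<Longrightarrow> (\<Sum>i<n. (u i)\<^sup>2) = 1 \<and> (\<Sum>j<n. (v j)\<^sup>2) = 1"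
  shows "(\<integral>\<xi>. exp_smax l \<beta> T (\<lambda>t. bilin n (fst t) (snd t) \<xi>) \<partial>gaussian (square n))
     \<le> real (card T) powr (l / \<beta>) * exp (2 * l * sqrt (real n) + l\<^sup>2 / 2)"
proof -
  let ?I = "square (Suc n)"
  define J where "J = ?I - {(n, n)}"
  have fin: "finite ?I" "finite J" "(n, n) \<notin> J" and I: "?I = insert (n, n) J" and sub: "square n \<subseteq> J"
    by (auto simp: J_def)
  have \<beta>: "0 < \<beta>" using l by simp
  let ?X = "\<lambda>\<xi>. exp_smax l \<beta> T (\<lambda>t. bilin n (fst t) (snd t) \<xi>)"
  have Xeq: "exp_smax l \<beta> T (\<lambda>t. linform ?I (matrix_weights n t) \<xi>) = ?X \<xi> * exp (l * \<xi> (n, n))" for \<xi>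
    using exp_smax_shift[OF \<beta>, of l T "\<lambda>t. bilin n (fst t) (snd t) \<xi>" "\<xi> (n, n)"]
    by (simp add: linform_matrix_weights[symmetric])
  have upd: "?X (\<xi>((n, n) := y)) = ?X \<xi>" for \<xi> y
  proof -
    have "bilin n u v (\<xi>((n, n) := y)) = bilin n u v \<xi>" for u v
      unfolding bilin_def by (auto intro!: sum.cong)
    then show ?thesis by simp
  qed
  \<comment> \<open>Integrating out the corner variable splits off the factor \<open>exp (l\<^sup>2 / 2)\<close>.\<close>
  have "(\<integral>\<xi>. exp_smax l \<beta> T (\<lambda>t. linform ?I (matrix_weights n t) \<xi>) \<partial>gaussian ?I)
     = (\<integral>\<xi>. (\<integral>y. ?X \<xi> * exp (l * y) \<partial>std_gaussian) \<partial>gaussian J)"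
    using gaussian_integral_insert[OF fin(2,3), of "\<lambda>\<xi>. exp_smax l \<beta> T (\<lambda>t. linform ?I (matrix_weights n t) \<xi>)"]
      exp_growth_integrable[OF fin(1) exp_growth_exp_smax[OF fin(1) T l, where w = "matrix_weights n"]]
    unfolding I[symmetric] by (simp add: Xeq upd)
  also have "\<dots> = (\<integral>\<xi>. ?X \<xi> \<partial>gaussian J) * exp (l\<^sup>2 / 2)"
    using std_gaussian_exp[of l] by (simp add: has_bochner_integral_iff)
  also have "(\<integral>\<xi>. ?X \<xi> \<partial>gaussian J) = (\<integral>\<xi>. ?X \<xi> \<partial>gaussian (square n))"
    by (rule gaussian_integral_restrict[OF _ sub]) (auto simp: bilin_restrict)
  finally have lhs: "(\<integral>\<xi>. exp_smax l \<beta> T (\<lambda>t. linform ?I (matrix_weights n t) \<xi>) \<partial>gaussian ?I)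
     = (\<integral>\<xi>. ?X \<xi> \<partial>gaussian (square n)) * exp (l\<^sup>2 / 2)" .
  have "(\<integral>\<xi>. exp_smax l \<beta> T (\<lambda>t. linform ?I (matrix_weights n t) \<xi>) \<partial>gaussian ?I)
     \<le> (\<integral>\<xi>. exp_smax l \<beta> T (\<lambda>t. linform ?I (border_weights n t) \<xi>) \<partial>gaussian ?I)"
  proof (rule gaussian_comparison[OF fin(1) T l])
    fix t s assume ts: "t \<in> T" "s \<in> T"
    obtain u v where t: "t = (u, v)" by force
    obtain u' v' where s: "s = (u', v')" by force
    let ?p = "\<Sum>i<n. u i * u' i" and ?q = "\<Sum>j<n. v j * v' j"
    have "?p \<le> 1" "?q \<le> 1"
      using unit ts by (auto intro!: inner_le_one simp: t s)
    then have "0 \<le> (1 - ?p) * (1 - ?q)" by (intro mult_nonneg_nonneg) auto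
    then show "(\<Sum>k\<in>?I. border_weights n t k * border_weights n s k) \<le> (\<Sum>k\<in>?I. matrix_weights n t k * matrix_weights n s k)"
      unfolding t s inner_matrix_weights inner_border_weights by (simp add: algebra_simps)
    show "(\<Sum>k\<in>?I. matrix_weights n t k * matrix_weights n t k) = (\<Sum>k\<in>?I. border_weights n t k * border_weights n t k)"
      using unit ts unfolding t inner_matrix_weights inner_border_weights by (simp add: power2_eq_square)
  qed (rule inner_matrix_border_weights)
  also have "\<dots> \<le> real (card T) powr (l / \<beta>) * exp (2 * l * sqrt (real n) + l\<^sup>2)"
  proof -
    define A where "A = l + sqrt (real n)"
    \<comment> \<open>The coordinates of \<open>g\<close> and \<open>h\<close>.\<close>
    define K where "K = ({..<n} \<times> {n}) \<union> ({n} \<times> {..<n})"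
    have "0 < sqrt (real n)" using n by simp
    then have A: "0 < A" "l < A" using l unfolding A_def by linarith+
    have K: "K \<subseteq> ?I" by (auto simp: K_def)
    have "card K = card ({..<n} \<times> {n}) + card ({n} \<times> {..<n})"
      unfolding K_def by (rule card_Un_disjoint) auto
    then have cK: "card K = 2 * n" by simp
    have sumK: "(\<Sum>k\<in>K. (\<xi> k)\<^sup>2) = (\<Sum>i<n. (\<xi> (i, n))\<^sup>2) + (\<Sum>j<n. (\<xi> (n, j))\<^sup>2)" for \<xi> :: "nat \<times> nat \<Rightarrow> real"
    proof -
      have "(\<Sum>k\<in>K. (\<xi> k)\<^sup>2) = (\<Sum>k\<in>{..<n} \<times> {n}. (\<xi> k)\<^sup>2) + (\<Sum>k\<in>{n} \<times> {..<n}. (\<xi> k)\<^sup>2)"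
        unfolding K_def by (rule sum.union_disjoint) auto
      also have "(\<Sum>k\<in>{..<n} \<times> {n}. (\<xi> k)\<^sup>2) = (\<Sum>i<n. \<Sum>j\<in>{n}. (\<xi> (i, j))\<^sup>2)"
        unfolding sum.cartesian_product by (simp add: case_prod_unfold)
      also have "(\<Sum>k\<in>{n} \<times> {..<n}. (\<xi> k)\<^sup>2) = (\<Sum>i\<in>{n}. \<Sum>j<n. (\<xi> (i, j))\<^sup>2)"
        unfolding sum.cartesian_product by (simp add: case_prod_unfold)
      finally show ?thesis by simp
    qed
    have le: "exp_smax l \<beta> T (\<lambda>t. linform ?I (border_weights n t) \<xi>)
       \<le> real (card T) powr (l / \<beta>) * exp (l * A) * exp (l / A / 2 * (\<Sum>k\<in>K. (\<xi> k)\<^sup>2))" for \<xi>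
    proof -
      have "linform ?I (border_weights n t) \<xi> \<le> A + (\<Sum>k\<in>K. (\<xi> k)\<^sup>2) / (2 * A)" if "t \<in> T" for t
      proof -
        obtain u v where t: "t = (u, v)" by force
        show ?thesis
          using unit_inner_le[of u n A "\<lambda>i. \<xi> (i, n)"] unit_inner_le[of v n A "\<lambda>j. \<xi> (n, j)"] unit[of u v] that A
          unfolding t linform_border_weights sumK by (simp add: add_divide_distrib)
      qed
      then have "exp_smax l \<beta> T (\<lambda>t. linform ?I (border_weights n t) \<xi>)
          \<le> real (card T) powr (l / \<beta>) * exp (l * (A + (\<Sum>k\<in>K. (\<xi> k)\<^sup>2) / (2 * A)))"
        by (rule exp_smax_le_card[OF T(1) l(1) \<beta>])
      also have "exp (l * (A + (\<Sum>k\<in>K. (\<xi> k)\<^sup>2) / (2 * A))) = exp (l * A) * exp (l / A / 2 * (\<Sum>k\<in>K. (\<xi> k)\<^sup>2))"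
        unfolding exp_add[symmetric] by (simp add: distrib_left mult.commute)
      finally show ?thesis by (simp only: mult.assoc)
    qed
    have sq: "has_bochner_integral (gaussian ?I) (\<lambda>\<xi>. exp (l / A / 2 * (\<Sum>k\<in>K. (\<xi> k)\<^sup>2))) ((1 / sqrt (1 - l / A)) ^ (2 * n))"
      unfolding cK[symmetric] using A l by (intro gaussian_exp_squares fin K) auto
    have "(\<integral>\<xi>. exp_smax l \<beta> T (\<lambda>t. linform ?I (border_weights n t) \<xi>) \<partial>gaussian ?I)
      \<le> (\<integral>\<xi>. real (card T) powr (l / \<beta>) * exp (l * A) * exp (l / A / 2 * (\<Sum>k\<in>K. (\<xi> k)\<^sup>2)) \<partial>gaussian ?I)"
      by (rule integral_mono[OF exp_growth_integrable[OF fin(1) exp_growth_exp_smax[OF fin(1) T l]] _ le])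
         (use sq in \<open>auto simp: has_bochner_integral_iff\<close>)
    also have "\<dots> = real (card T) powr (l / \<beta>) * (exp (l * A) * (1 / sqrt (1 - l / A)) ^ (2 * n))"
      using sq by (simp add: has_bochner_integral_iff mult.assoc)
    also have "\<dots> \<le> real (card T) powr (l / \<beta>) * exp (2 * l * sqrt (real n) + l\<^sup>2)"
      unfolding A_def using l n by (intro mult_left_mono chernoff_constant_bound) auto
    finally show ?thesis .
  qed
  finally have "(\<integral>\<xi>. ?X \<xi> \<partial>gaussian (square n)) * exp (l\<^sup>2 / 2)
     \<le> real (card T) powr (l / \<beta>) * exp (2 * l * sqrt (real n) + l\<^sup>2 / 2) * exp (l\<^sup>2 / 2)"
    unfolding lhs by (simp add: mult.assoc exp_add[symmetric] algebra_simps)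
  then show ?thesis by simp
qed

text \<open>
Markov's inequality with \<open>l = \<epsilon>\<close>, followed by the limit \<open>\<beta> \<rightarrow> \<infinity>\<close>, which removes the dependence on the
cardinality of \<open>T\<close>.
\<close>

lemma gaussian_bilin_tail_finite:
  assumes T: "finite T" and n: "0 < n" and \<epsilon>: "0 < \<epsilon>"
    and unit: "\<And>u v. (u, v) \<in> T \<Longrightarrow> (\<Sum>i<n. (u i)\<^sup>2) = 1 \<and> (\<Sum>j<n. (v j)\<^sup>2) = 1"
  shows "measure (gaussian (square n))
      (\<Union>(u, v)\<in>T. {\<xi> \<in> space (gaussian (square n)). 2 * sqrt (real n) + \<epsilon> < bilin n u v \<xi>})
    \<le> exp (- \<epsilon>\<^sup>2 / 2)"
    (is "measure ?M ?E \<le> _")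
proof (cases "T = {}")
  case False
  let ?\<tau> = "2 * sqrt (real n) + \<epsilon>"
  have bound: "measure ?M ?E \<le> real (card T) powr (\<epsilon> / \<beta>) * exp (- \<epsilon>\<^sup>2 / 2)" if \<beta>: "\<epsilon> < \<beta>" for \<beta>
  proof -
    let ?X = "\<lambda>\<xi>. exp_smax \<epsilon> \<beta> T (\<lambda>t. bilin n (fst t) (snd t) \<xi>)"
    have int: "integrable ?M ?X"
      unfolding bilin_eq_linform
      by (intro exp_growth_integrable exp_growth_exp_smax[OF _ T False \<epsilon> \<beta>]) auto
    have "measure ?M ?E \<le> measure ?M {\<xi> \<in> space ?M. exp (\<epsilon> * ?\<tau>) \<le> ?X \<xi>}"
    proof (rule gaussian_prob.finite_measure_mono)
      show "?E \<subseteq> {\<xi> \<in> space ?M. exp (\<epsilon> * ?\<tau>) \<le> ?X \<xi>}"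
      proof clarsimp
        fix u v \<xi> assume uv: "(u, v) \<in> T" and "?\<tau> < bilin n u v \<xi>"
        then have "exp (\<epsilon> * ?\<tau>) \<le> exp (\<epsilon> * bilin n u v \<xi>)" using \<epsilon> by auto
        also have "\<dots> \<le> ?X \<xi>"
          using exp_le_exp_smax[OF T \<epsilon> _ uv, of \<beta> "\<lambda>t. bilin n (fst t) (snd t) \<xi>"] \<epsilon> \<beta> by simp
        finally show "exp (\<epsilon> * ?\<tau>) \<le> ?X \<xi>" .
      qed
      show "{\<xi> \<in> space ?M. exp (\<epsilon> * ?\<tau>) \<le> ?X \<xi>} \<in> sets ?M"
        using borel_measurable_integrable[OF int] by measurable
    qed
    also have "\<dots> \<le> (\<integral>\<xi>. ?X \<xi> \<partial>?M) / exp (\<epsilon> * ?\<tau>)"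
      by (rule integral_Markov_inequality_measure[OF int, of "{}"]) (auto simp: exp_smax_nonneg)
    also have "\<dots> \<le> real (card T) powr (\<epsilon> / \<beta>) * exp (2 * \<epsilon> * sqrt (real n) + \<epsilon>\<^sup>2 / 2) / exp (\<epsilon> * ?\<tau>)"
      by (intro divide_right_mono gaussian_exp_smax_bilin T False \<epsilon> \<beta> n unit) auto
    also have "\<dots> = real (card T) powr (\<epsilon> / \<beta>) * exp (- \<epsilon>\<^sup>2 / 2)"
    proof -
      have "exp (2 * \<epsilon> * sqrt (real n) + \<epsilon>\<^sup>2 / 2) = exp (- \<epsilon>\<^sup>2 / 2) * exp (\<epsilon> * ?\<tau>)"
        unfolding exp_add[symmetric] by (simp add: algebra_simps power2_eq_square)
      then show ?thesis by simp
    qed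
    finally show ?thesis .
  qed
  have "((\<lambda>\<beta>. real (card T) powr (\<epsilon> / \<beta>) * exp (- \<epsilon>\<^sup>2 / 2)) \<longlongrightarrow> real (card T) powr 0 * exp (- \<epsilon>\<^sup>2 / 2)) at_top"
    using False T by (intro tendsto_mult tendsto_powr tendsto_const tendsto_divide_0[OF tendsto_const])
      (auto intro: filterlim_at_top_imp_at_infinity filterlim_ident)
  then have "measure ?M ?E \<le> real (card T) powr 0 * exp (- \<epsilon>\<^sup>2 / 2)"
    by (rule tendsto_lowerbound[OF _ eventually_mono[OF eventually_gt_at_top[of \<epsilon>] bound]]) simp_all
  then show ?thesis using False T by simp
qed simp

lemma (in prob_space) prob_countable_UN_le:
  assumes D: "countable D" and E: "\<And>t. t \<in> D \<Longrightarrow> E t \<in> events"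
    and le: "\<And>F. finite F \<Longrightarrow> F \<subseteq> D \<Longrightarrow> prob (\<Union>t\<in>F. E t) \<le> c"
  shows "prob (\<Union>t\<in>D. E t) \<le> c"
proof (cases "D = {}")
  case True then show ?thesis using le[of "{}"] by simp
next
  case False
  let ?F = "\<lambda>k. from_nat_into D ` {..k::nat}"
  have sub: "?F k \<subseteq> D" for k using from_nat_into[OF False] by auto
  have "(\<lambda>k. prob (\<Union>t\<in>?F k. E t)) \<longlonglongrightarrow> prob (\<Union>k. \<Union>t\<in>?F k. E t)"
  proof (rule finite_Lim_measure_incseq)
    show "range (\<lambda>k. \<Union>t\<in>?F k. E t) \<subseteq> events"
      using sub E by (intro image_subsetI sets.finite_UN) blast+
    show "incseq (\<lambda>k. \<Union>t\<in>?F k. E t)"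
      by (intro incseq_SucI UN_mono image_mono) auto
  qed
  then have "prob (\<Union>k. \<Union>t\<in>?F k. E t) \<le> c"
    by (rule LIMSEQ_le_const2) (use le sub in blast)
  also have "(\<Union>k. \<Union>t\<in>?F k. E t) = (\<Union>t\<in>D. E t)"
  proof -
    have "(\<Union>k. ?F k) = range (from_nat_into D)" by auto
    also have "\<dots> = D" by (rule range_from_nat_into[OF False D])
    finally show ?thesis by (metis UN_UN_flatten)
  qed
  finally show ?thesis .
qed

text \<open>
Normalized integer vectors are dense in the unit sphere, and there are only countably many of them.
Integers suffice, instead of rationals, because bilinear forms and norms are homogeneous.
\<close>

definition unit_vector :: "nat \<Rightarrow> (nat \<Rightarrow> int) \<Rightarrow> nat \<Rightarrow> real" where
  "unit_vector n p = (\<lambda>i. real_of_int (p i) / sqrt (\<Sum>k<n. (real_of_int (p k))\<^sup>2))"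

text \<open>
Lists serve as integer vectors because there are only countably many of them; entries beyond the length of a
list have unspecified values.
\<close>

definition unit_net :: "nat \<Rightarrow> (nat \<Rightarrow> real) set" where
  "unit_net n = (\<lambda>xs. unit_vector n ((!) xs)) ` {xs. (\<exists>k<n. xs ! k \<noteq> 0)}"

lemma countable_unit_net: "countable (unit_net n)"
  unfolding unit_net_def by (intro countable_image) simp

lemma unit_net_unit: "u \<in> unit_net n \<Longrightarrow> (\<Sum>i<n. (u i)\<^sup>2) = 1"
proof -
  assume "u \<in> unit_net n"
  then obtain xs :: "int list" and k where u: "u = unit_vector n ((!) xs)" and k: "k < n" "xs ! k \<noteq> 0"
    by (auto simp: unit_net_def)
  have "0 < (\<Sum>k<n. (real_of_int (xs ! k))\<^sup>2)"
    using k by (intro sum_pos2[where i = k]) auto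
  then show ?thesis
    unfolding u unit_vector_def by (simp add: power_divide sum_divide_distrib[symmetric] sum_nonneg)
qed

text \<open>
By homogeneity the bound on the net extends to integer vectors, then to vectors with entries
\<open>\<lfloor>k x\<^sub>i\<rfloor> / k\<close>, and in the limit \<open>k \<rightarrow> \<infinity>\<close> to all real vectors.
\<close>

lemma bilin_le_if_net_le:
  assumes \<tau>: "0 \<le> \<tau>" and net: "\<And>u v. u \<in> unit_net n \<Longrightarrow> v \<in> unit_net n \<Longrightarrow> bilin n u v \<xi> \<le> \<tau>"
  shows "bilin n x y \<xi> \<le> \<tau> * (sqrt (\<Sum>i<n. (x i)\<^sup>2) * sqrt (\<Sum>i<n. (y i)\<^sup>2))"
proof -
  let ?N = "\<lambda>x. sqrt (\<Sum>i<n. (x i)\<^sup>2) :: real"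
  have cong: "bilin n x y \<xi> = bilin n x' y' \<xi>" if "\<And>i. i < n \<Longrightarrow> x i = x' i" "\<And>i. i < n \<Longrightarrow> y i = y' i" for x y x' y'
    unfolding bilin_def using that by simp
  have scale: "bilin n (\<lambda>i. a * x i) (\<lambda>i. b * y i) \<xi> = a * b * bilin n x y \<xi>" for a b x y
    unfolding bilin_def by (simp add: sum_distrib_left mult_ac)
  have int: "bilin n (\<lambda>i. of_int (p i)) (\<lambda>i. of_int (q i)) \<xi> \<le> \<tau> * (?N (\<lambda>i. of_int (p i)) * ?N (\<lambda>i. of_int (q i)))" for p q
  proof (cases "(\<exists>k<n. p k \<noteq> 0) \<and> (\<exists>k<n. q k \<noteq> 0)")
    case True
    have net_mem: "\<exists>u\<in>unit_net n. (\<forall>i<n. real_of_int (p i) = ?N (\<lambda>i. of_int (p i)) * u i)" if p: "\<exists>k<n. p k \<noteq> 0" for p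
    proof
      have sums: "(\<Sum>k<n. (real_of_int (map p [0..<n] ! k))\<^sup>2) = (\<Sum>k<n. (real_of_int (p k))\<^sup>2)" by simp
      show "unit_vector n ((!) (map p [0..<n])) \<in> unit_net n"
        unfolding unit_net_def using p by (intro imageI) auto
      have "0 < (\<Sum>k<n. (real_of_int (p k))\<^sup>2)"
        using p by (auto intro!: sum_pos2)
      then show "\<forall>i<n. real_of_int (p i) = ?N (\<lambda>i. of_int (p i)) * unit_vector n ((!) (map p [0..<n])) i"
        unfolding unit_vector_def sums by simp
    qed
    obtain u where u: "u \<in> unit_net n" "\<forall>i<n. real_of_int (p i) = ?N (\<lambda>i. of_int (p i)) * u i"
      using net_mem True by blast
    obtain v where v: "v \<in> unit_net n" "\<forall>i<n. real_of_int (q i) = ?N (\<lambda>i. of_int (q i)) * v i"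
      using net_mem True by blast
    define a where "a = ?N (\<lambda>i. of_int (p i))"
    define b where "b = ?N (\<lambda>i. of_int (q i))"
    have "bilin n (\<lambda>i. of_int (p i)) (\<lambda>i. of_int (q i)) \<xi> = bilin n (\<lambda>i. a * u i) (\<lambda>i. b * v i) \<xi>"
      by (rule cong) (simp_all add: u(2)[folded a_def] v(2)[folded b_def])
    also have "\<dots> \<le> a * b * \<tau>"
      unfolding scale using net[OF u(1) v(1)] by (intro mult_left_mono) (auto simp: a_def b_def sum_nonneg)
    finally have "bilin n (\<lambda>i. of_int (p i)) (\<lambda>i. of_int (q i)) \<xi> \<le> a * b * \<tau>" .
    then show ?thesis unfolding a_def b_def by (simp add: mult_ac)
  next
    case False
    then have "bilin n (\<lambda>i. of_int (p i)) (\<lambda>i. of_int (q i)) \<xi> = 0" by (auto simp: bilin_def)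
    then show ?thesis using \<tau> by (simp add: sum_nonneg)
  qed
  \<comment> \<open>The successor keeps the denominator positive.\<close>
  let ?r = "\<lambda>k x. real_of_int \<lfloor>real (Suc k) * x\<rfloor> / real (Suc k)"
  have r: "(\<lambda>k. ?r k x) \<longlonglongrightarrow> x" for x :: real
    by real_asymp
  have "(\<lambda>k. bilin n (\<lambda>i. ?r k (x i)) (\<lambda>i. ?r k (y i)) \<xi>) \<longlonglongrightarrow> bilin n x y \<xi>"
    unfolding bilin_def by (intro tendsto_intros r)
  moreover have "(\<lambda>k. \<tau> * (?N (\<lambda>i. ?r k (x i)) * ?N (\<lambda>i. ?r k (y i)))) \<longlonglongrightarrow> \<tau> * (?N x * ?N y)"
    by (intro tendsto_intros r)
  moreover have "bilin n (\<lambda>i. ?r k (x i)) (\<lambda>i. ?r k (y i)) \<xi> \<le> \<tau> * (?N (\<lambda>i. ?r k (x i)) * ?N (\<lambda>i. ?r k (y i)))" for k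
  proof -
    let ?p = "\<lambda>i. \<lfloor>real (Suc k) * x i\<rfloor>" and ?q = "\<lambda>i. \<lfloor>real (Suc k) * y i\<rfloor>" and ?a = "1 / real (Suc k)"
    have N: "?N (\<lambda>i. ?a * of_int (p i)) = ?a * ?N (\<lambda>i. of_int (p i))" for p :: "nat \<Rightarrow> int"
      by (simp add: power_mult_distrib power_divide sum_divide_distrib[symmetric] real_sqrt_divide del: of_nat_Suc)
    have "bilin n (\<lambda>i. ?a * of_int (?p i)) (\<lambda>i. ?a * of_int (?q i)) \<xi>
       \<le> ?a * ?a * (\<tau> * (?N (\<lambda>i. of_int (?p i)) * ?N (\<lambda>i. of_int (?q i))))"
      unfolding scale using int[of ?p ?q] by (intro mult_left_mono) auto
    also have "\<dots> = \<tau> * (?N (\<lambda>i. ?a * of_int (?p i)) * ?N (\<lambda>i. ?a * of_int (?q i)))"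
      unfolding N by (simp only: mult_ac)
    finally show ?thesis by (simp only: times_divide_eq_left mult_1_left)
  qed
  ultimately show ?thesis by (intro LIMSEQ_le) auto
qed

text \<open>
The exceptional event is a union over the countable net, hence the limit of increasing finite unions, and
the bound for finite unions does not depend on their size.
\<close>

theorem gaussian_operator_norm_tail:
  assumes n: "0 < n" and \<epsilon>: "0 < \<epsilon>"
  shows "measure (gaussian (square n))
     {\<xi> \<in> space (gaussian (square n)). \<forall>u\<in>unit_net n. \<forall>v\<in>unit_net n. bilin n u v \<xi> \<le> 2 * sqrt (real n) + \<epsilon>}
    \<ge> 1 - exp (- \<epsilon>\<^sup>2 / 2)"
proof -
  let ?M = "gaussian (square n)" and ?\<tau> = "2 * sqrt (real n) + \<epsilon>"
  let ?D = "unit_net n \<times> unit_net n"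
  let ?E = "\<lambda>(u, v). {\<xi> \<in> space ?M. ?\<tau> < bilin n u v \<xi>}"
  have E: "?E t \<in> sets ?M" for t by (cases t) simp
  have D: "countable ?D" by (intro countable_SIGMA countable_unit_net)
  have "measure ?M (\<Union>t\<in>?D. ?E t) \<le> exp (- \<epsilon>\<^sup>2 / 2)"
  proof (rule gaussian_prob.prob_countable_UN_le[OF D E])
    fix F assume F: "finite F" "F \<subseteq> ?D"
    show "measure ?M (\<Union>t\<in>F. ?E t) \<le> exp (- \<epsilon>\<^sup>2 / 2)"
      by (rule gaussian_bilin_tail_finite[OF F(1) n \<epsilon>]) (use F(2) unit_net_unit in blast)
  qed
  moreover have "{\<xi> \<in> space ?M. \<forall>u\<in>unit_net n. \<forall>v\<in>unit_net n. bilin n u v \<xi> \<le> ?\<tau>} = space ?M - (\<Union>t\<in>?D. ?E t)"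
    by (auto simp: not_less; meson not_le)
  moreover have "(\<Union>t\<in>?D. ?E t) \<in> sets ?M" using D E by (intro sets.countable_UN') auto
  ultimately show ?thesis by (simp add: gaussian_prob.prob_compl)
qed

section \<open>Almost sure invertibility\<close>

lemma AE_std_gaussian_neq: "AE x in std_gaussian. x \<noteq> c"
  unfolding std_gaussian_def using AE_lborel_singleton[of c]
  by (subst AE_density) auto

lemma AE_gaussian_insert:
  assumes "finite J" "k \<notin> J" and meas: "{\<xi> \<in> space (gaussian (insert k J)). \<not> P \<xi>} \<in> sets (gaussian (insert k J))"
    and AE: "AE \<xi> in gaussian J. AE x in std_gaussian. P (\<xi>(k := x))"
  shows "AE \<xi> in gaussian (insert k J). P \<xi>"
proof -
  let ?N = "{\<xi> \<in> space (gaussian (insert k J)). \<not> P \<xi>}"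
  have "(\<integral>\<^sup>+\<xi>. indicator ?N \<xi> \<partial>gaussian (insert k J))
      = (\<integral>\<^sup>+\<xi>. (\<integral>\<^sup>+x. indicator ?N (\<xi>(k := x)) \<partial>std_gaussian) \<partial>gaussian J)"
    using assms(1,2) meas unfolding gaussian_def
    by (intro gaussian.product_nn_integral_insert) auto
  also have "\<dots> = (\<integral>\<^sup>+\<xi>. 0 \<partial>gaussian J)"
  proof (rule nn_integral_cong_AE, use AE in eventually_elim)
    fix \<xi> assume "AE x in std_gaussian. P (\<xi>(k := x))"
    then have "(\<integral>\<^sup>+x. indicator ?N (\<xi>(k := x)) \<partial>std_gaussian) = (\<integral>\<^sup>+x. 0 \<partial>std_gaussian)"
      by (intro nn_integral_cong_AE) (auto elim!: eventually_mono)
    then show "(\<integral>\<^sup>+x. indicator ?N (\<xi>(k := x)) \<partial>std_gaussian) = 0" by simp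
  qed
  finally have "emeasure (gaussian (insert k J)) ?N = 0" using meas by simp
  then show ?thesis by (rule AE_I[OF subset_refl _ meas])
qed

text \<open>
Induction on the set of coordinates. If \<open>f \<eta> \<noteq> 0\<close>, then fixing one coordinate at \<open>\<eta> k\<close> leaves a function of
the same kind, which is nonzero almost everywhere. Where it is nonzero, \<open>f\<close> is a nonzero affine function
of the coordinate \<open>k\<close> and vanishes for at most one value, a null event for a normal variable.
\<close>

lemma AE_gaussian_multiaffine_nonzero:
  fixes f :: "('i \<Rightarrow> real) \<Rightarrow> real"
  assumes "finite I" "f \<in> borel_measurable (gaussian I)"
    and "\<And>\<xi>. f (restrict \<xi> I) = f \<xi>"
    and "\<And>k \<xi> x. k \<in> I \<Longrightarrow> f (\<xi>(k := x)) = f (\<xi>(k := 0)) + x * (f (\<xi>(k := 1)) - f (\<xi>(k := 0)))"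
    and "f \<eta> \<noteq> 0"
  shows "AE \<xi> in gaussian I. f \<xi> \<noteq> 0"
  using assms
proof (induction I arbitrary: f rule: finite_induct)
  case empty
  have "f \<xi> \<noteq> 0" for \<xi> using empty(2)[of \<xi>] empty(2)[of \<eta>] empty(4) by simp
  then show ?case by simp
next
  case (insert k J)
  note meas = insert.prems(1) and dep = insert.prems(2) and aff = insert.prems(3)
  have upd [measurable]: "(\<lambda>\<xi>. \<xi>(k := c)) \<in> gaussian J \<rightarrow>\<^sub>M gaussian (insert k J)" for c
    unfolding gaussian_def by (rule measurable_fun_upd[of _ J]) auto
  have "AE \<xi> in gaussian J. f (\<xi>(k := \<eta> k)) \<noteq> 0"
  proof (rule insert.IH)
    show "(\<lambda>\<xi>. f (\<xi>(k := \<eta> k))) \<in> borel_measurable (gaussian J)"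
      by (rule measurable_compose[OF upd meas])
    show "f ((restrict \<xi> J)(k := \<eta> k)) = f (\<xi>(k := \<eta> k))" for \<xi>
    proof -
      have "(restrict \<xi> J)(k := \<eta> k) = restrict (\<xi>(k := \<eta> k)) (insert k J)"
        by (auto simp: fun_eq_iff)
      then show ?thesis by (simp only: dep)
    qed
    show "f (\<eta>(k := \<eta> k)) \<noteq> 0" using insert.prems(4) by simp
    fix j \<xi> x assume j: "j \<in> J"
    then have "j \<noteq> k" using insert.hyps by auto
    then have "\<xi>(j := y, k := \<eta> k) = \<xi>(k := \<eta> k, j := y)" for y by (rule fun_upd_twist)
    then show "f (\<xi>(j := x, k := \<eta> k)) =
        f (\<xi>(j := 0, k := \<eta> k)) + x * (f (\<xi>(j := 1, k := \<eta> k)) - f (\<xi>(j := 0, k := \<eta> k)))"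
      using aff[of j "\<xi>(k := \<eta> k)" x] j by (simp only: insert_iff simp_thms)
  qed
  then have AE: "AE \<xi> in gaussian J. AE x in std_gaussian. f (\<xi>(k := x)) \<noteq> 0"
  proof eventually_elim
    fix \<xi> assume nz: "f (\<xi>(k := \<eta> k)) \<noteq> 0"
    define p q where "p = f (\<xi>(k := 0))" and "q = f (\<xi>(k := 1)) - f (\<xi>(k := 0))"
    have f: "f (\<xi>(k := x)) = p + x * q" for x
      unfolding p_def q_def by (rule aff) simp
    show "AE x in std_gaussian. f (\<xi>(k := x)) \<noteq> 0"
      using AE_std_gaussian_neq[of "- p / q"]
    proof eventually_elim
      fix x assume x: "x \<noteq> - p / q"
      show "f (\<xi>(k := x)) \<noteq> 0"
      proof (cases "q = 0")
        case True then show ?thesis using nz unfolding f by simp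
      next
        case False then show ?thesis using x unfolding f by (auto simp: field_simps)
      qed
    qed
  qed
  show ?case
  proof (rule AE_gaussian_insert[OF insert.hyps _ AE])
    note [measurable] = meas
    show "{\<xi> \<in> space (gaussian (insert k J)). \<not> f \<xi> \<noteq> 0} \<in> sets (gaussian (insert k J))"
      by measurable
  qed
qed

definition det_fun :: "nat \<Rightarrow> (nat \<times> nat \<Rightarrow> real) \<Rightarrow> real" where
  "det_fun n \<xi> = Determinant.det (mat n n \<xi>)"

lemma det_fun_expand:
  "det_fun n \<xi> = (\<Sum>p | p permutes {0..<n}. signof p * (\<Prod>i = 0..<n. \<xi> (i, p i)))"
proof -
  have "(\<Prod>i = 0..<n. mat n n \<xi> $$ (i, p i)) = (\<Prod>i = 0..<n. \<xi> (i, p i))" if "p permutes {0..<n}" for p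
    using permutes_in_image[OF that] by (intro prod.cong) auto
  then show ?thesis unfolding det_fun_def by (simp add: det_def'[of _ n])
qed

lemma det_fun_measurable [measurable]: "det_fun n \<in> borel_measurable (gaussian (square n))"
proof -
  have "(\<lambda>\<xi>. \<Prod>i = 0..<n. \<xi> (i, p i)) \<in> borel_measurable (gaussian (square n))" if "p permutes {0..<n}" for p
    using permutes_in_image[OF that]
    by (intro borel_measurable_prod measurable_gaussian_component) auto
  then have "(\<lambda>\<xi>. \<Sum>p | p permutes {0..<n}. signof p * (\<Prod>i = 0..<n. \<xi> (i, p i))) \<in> borel_measurable (gaussian (square n))"
    by (intro borel_measurable_sum borel_measurable_times) auto
  then show ?thesis by (simp add: det_fun_expand[abs_def])
qed

lemma mat_restrict_square: "mat n n (restrict \<xi> (square n)) = mat n n \<xi>"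
  by (rule eq_matI) auto

text \<open>
Each summand of the Leibniz expansion contains every entry of the matrix at most once.
\<close>

lemma det_fun_affine:
  assumes "k \<in> square n"
  shows "det_fun n (\<xi>(k := x)) = det_fun n (\<xi>(k := 0)) + x * (det_fun n (\<xi>(k := 1)) - det_fun n (\<xi>(k := 0)))"
proof -
  obtain a b where k: "k = (a, b)" and a: "a < n" using assms by auto
  have summand: "(\<Prod>i = 0..<n. (\<xi>(k := x)) (i, p i)) = (\<Prod>i = 0..<n. (\<xi>(k := 0)) (i, p i)) +
      x * ((\<Prod>i = 0..<n. (\<xi>(k := 1)) (i, p i)) - (\<Prod>i = 0..<n. (\<xi>(k := 0)) (i, p i)))" for p
  proof -
    have "(\<Prod>i = 0..<n. (\<xi>(k := y)) (i, p i)) = (if p a = b then y else \<xi> (a, p a)) * (\<Prod>i\<in>{0..<n} - {a}. \<xi> (i, p i))" for y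
    proof -
      have "(\<Prod>i\<in>{0..<n} - {a}. (\<xi>(k := y)) (i, p i)) = (\<Prod>i\<in>{0..<n} - {a}. \<xi> (i, p i))"
        by (intro prod.cong) (auto simp: k)
      then show ?thesis using a by (subst prod.remove[of _ a]) (auto simp: k)
    qed
    then show ?thesis by (auto simp: algebra_simps)
  qed
  show ?thesis
    unfolding det_fun_expand sum_subtractf[symmetric] sum_distrib_left sum.distrib[symmetric]
    by (intro sum.cong refl, subst summand) (simp add: algebra_simps)
qed

lemma AE_det_fun_nonzero: "AE \<xi> in gaussian (square n). det_fun n \<xi> \<noteq> 0"
proof (rule AE_gaussian_multiaffine_nonzero[OF _ det_fun_measurable _ det_fun_affine])
  \<comment> \<open>The identity matrix is a point where the determinant does not vanish.\<close>
  have "mat n n (\<lambda>(i, j). if i = j then 1 else 0) = (1\<^sub>m n :: real mat)" by (rule eq_matI) auto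
  then show "det_fun n (\<lambda>(i, j). if i = j then 1 else 0) \<noteq> 0" by (simp add: det_fun_def)
  show "det_fun n (restrict \<xi> (square n)) = det_fun n \<xi>" for \<xi>
    by (simp only: det_fun_def mat_restrict_square)
qed auto

section \<open>Second and fourth moments of linear forms\<close>

lemma gaussian_stein_linform:
  assumes I: "finite I" and H: "exp_growth I H" and H': "\<And>k. k \<in> I \<Longrightarrow> exp_growth I (H' k)"
    and deriv: "\<And>k \<xi> x. k \<in> I \<Longrightarrow> ((\<lambda>y. H (\<xi>(k := y))) has_real_derivative H' k (\<xi>(k := x))) (at x)"
    and cont: "\<And>k \<xi> x. k \<in> I \<Longrightarrow> isCont (\<lambda>y. H' k (\<xi>(k := y))) x"
  shows "(\<integral>\<xi>. linform I u \<xi> * H \<xi> \<partial>gaussian I) = (\<Sum>k\<in>I. u k * (\<integral>\<xi>. H' k \<xi> \<partial>gaussian I))"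
proof -
  have "(\<integral>\<xi>. linform I u \<xi> * H \<xi> \<partial>gaussian I) = (\<integral>\<xi>. (\<Sum>k\<in>I. u k * (\<xi> k * H \<xi>)) \<partial>gaussian I)"
    unfolding linform_def by (simp add: sum_distrib_right mult.assoc)
  also have "\<dots> = (\<Sum>k\<in>I. u k * (\<integral>\<xi>. \<xi> k * H \<xi> \<partial>gaussian I))"
  proof (subst Bochner_Integration.integral_sum)
    show "integrable (gaussian I) (\<lambda>\<xi>. u k * (\<xi> k * H \<xi>))" if "k \<in> I" for k
      by (intro exp_growth_integrable exp_growth_mult exp_growth_const exp_growth_component H I that)
  qed simp
  also have "\<dots> = (\<Sum>k\<in>I. u k * (\<integral>\<xi>. H' k \<xi> \<partial>gaussian I))"
    by (intro sum.cong refl arg_cong2[where f = "(*)"] gaussian_stein I H H' deriv cont)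
  finally show ?thesis .
qed

lemma gaussian_covariance:
  assumes I: "finite I"
  shows "(\<integral>\<xi>. linform I u \<xi> * linform I v \<xi> \<partial>gaussian I) = (\<Sum>k\<in>I. u k * v k)"
proof -
  have "(\<integral>\<xi>. linform I u \<xi> * linform I v \<xi> \<partial>gaussian I) = (\<Sum>k\<in>I. u k * (\<integral>\<xi>. v k \<partial>gaussian I))"
    by (rule gaussian_stein_linform[OF I]) (auto intro: exp_growth_linform exp_growth_const I linform_deriv)
  then show ?thesis by (simp add: gaussian_prob.prob_space)
qed

text \<open>
Stein's identity for the first factor \<open>U\<close> of \<open>U * (U V\<^sup>2)\<close>: differentiation of \<open>U V\<^sup>2\<close> gives
\<open>\<langle>u, u\<rangle> E V\<^sup>2 + 2 \<langle>u, v\<rangle> E (U V)\<close>, which contains only covariances.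
\<close>

lemma gaussian_mixed_fourth_moment:
  assumes I: "finite I"
  shows "(\<integral>\<xi>. (linform I u \<xi>)\<^sup>2 * (linform I v \<xi>)\<^sup>2 \<partial>gaussian I)
     = (\<Sum>k\<in>I. (u k)\<^sup>2) * (\<Sum>k\<in>I. (v k)\<^sup>2) + 2 * (\<Sum>k\<in>I. u k * v k)\<^sup>2"
proof -
  let ?U = "linform I u" and ?V = "linform I v"
  note growth = exp_growth_mult exp_growth_add exp_growth_const exp_growth_linform exp_growth_power I
  have int: "integrable (gaussian I) (\<lambda>\<xi>. ?V \<xi> * ?V \<xi>)" "integrable (gaussian I) (\<lambda>\<xi>. ?U \<xi> * ?V \<xi>)"
    by (intro exp_growth_integrable growth)+
  have "(\<integral>\<xi>. ?U \<xi> * (?U \<xi> * (?V \<xi>)\<^sup>2) \<partial>gaussian I)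
    = (\<Sum>k\<in>I. u k * (\<integral>\<xi>. u k * (?V \<xi> * ?V \<xi>) + 2 * v k * (?U \<xi> * ?V \<xi>) \<partial>gaussian I))"
  proof (rule gaussian_stein_linform[OF I])
    fix k \<xi> x assume k: "k \<in> I"
    note d = linform_deriv[OF I k]
    show "((\<lambda>y. ?U (\<xi>(k := y)) * (?V (\<xi>(k := y)))\<^sup>2) has_real_derivative
       u k * (?V (\<xi>(k := x)) * ?V (\<xi>(k := x))) + 2 * v k * (?U (\<xi>(k := x)) * ?V (\<xi>(k := x)))) (at x)"
      by (auto intro!: derivative_eq_intros d simp: power2_eq_square algebra_simps)
    show "isCont (\<lambda>y. u k * (?V (\<xi>(k := y)) * ?V (\<xi>(k := y))) + 2 * v k * (?U (\<xi>(k := y)) * ?V (\<xi>(k := y)))) x"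
      by (intro continuous_intros DERIV_isCont[OF d])
  qed (intro growth)+
  also have "\<dots> = (\<Sum>k\<in>I. u k * (u k * (\<Sum>k\<in>I. v k * v k) + 2 * v k * (\<Sum>k\<in>I. u k * v k)))"
    using int by (simp add: gaussian_covariance[OF I])
  also have "\<dots> = (\<Sum>k\<in>I. (u k)\<^sup>2) * (\<Sum>k\<in>I. (v k)\<^sup>2) + 2 * (\<Sum>k\<in>I. u k * v k) * (\<Sum>k\<in>I. u k * v k)"
  proof -
    have "(\<Sum>k\<in>I. u k * (u k * p + 2 * v k * q)) = (\<Sum>k\<in>I. u k * u k) * p + 2 * (\<Sum>k\<in>I. u k * v k) * q" for p q
      by (simp add: distrib_left sum.distrib sum_distrib_left sum_distrib_right mult_ac)
    then show ?thesis by (simp add: power2_eq_square)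
  qed
  finally show ?thesis by (simp add: power2_eq_square mult_ac)
qed

section \<open>Inverses and operator norms of matrices\<close>

lemma invertible_mat_iff_det:
  fixes C :: "real mat"
  assumes C: "C \<in> carrier_mat n n"
  shows "invertible_mat C \<longleftrightarrow> Determinant.det C \<noteq> 0"
proof
  assume "invertible_mat C"
  then obtain D where D: "C * D = 1\<^sub>m (dim_row C)" "D * C = 1\<^sub>m (dim_row D)"
    unfolding invertible_mat_def inverts_mat_def by blast
  have "D \<in> carrier_mat n n"
    using D C by (metis carrier_matD carrier_matI index_mult_mat(2,3) index_one_mat(2,3))
  then have "Determinant.det C * Determinant.det D = 1" using D(1) C Determinant.det_mult[OF C, of D] by simp
  then show "Determinant.det C \<noteq> 0" by auto
next
  assume "Determinant.det C \<noteq> 0"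
  from det_non_zero_imp_unit[OF C this, of "()"]
  obtain D where "D \<in> carrier_mat n n" "D * C = 1\<^sub>m n" "C * D = 1\<^sub>m n"
    unfolding Units_def ring_mat_def by auto
  then show "invertible_mat C"
    unfolding invertible_mat_def inverts_mat_def using C by auto
qed

lemma mat_inv_nonsingular:
  assumes C: "C \<in> carrier_mat n n" and "Determinant.det C \<noteq> 0"
  shows "mat_inv C \<in> carrier_mat n n" "C * mat_inv C = 1\<^sub>m n" "mat_inv C * C = 1\<^sub>m n"
proof -
  obtain D where "mat_inverse C = Some D"
    using mat_inverse(1)[OF C, of "()"] det_non_zero_imp_unit[OF C assms(2), of "()"] by fastforce
  with mat_inverse(2)[OF C this]
  show "mat_inv C \<in> carrier_mat n n" "C * mat_inv C = 1\<^sub>m n" "mat_inv C * C = 1\<^sub>m n"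
    by (auto simp: mat_inv_def)
qed

lemma mat_inv_singular:
  assumes C: "C \<in> carrier_mat n n" and "Determinant.det C = 0"
  shows "mat_inv C = 0\<^sub>m n n"
proof (cases "mat_inverse C")
  case None then show ?thesis using C by (simp add: mat_inv_def)
next
  case (Some D)
  then have "C * D = 1\<^sub>m n" "D \<in> carrier_mat n n" using mat_inverse(2)[OF C Some] by auto
  then have "Determinant.det C * Determinant.det D = 1" using Determinant.det_mult[OF C, of D] by simp
  then show ?thesis using assms(2) by simp
qed

lemma mat_inv_carrier:
  assumes C: "C \<in> carrier_mat n n"
  shows "mat_inv C \<in> carrier_mat n n"
  using mat_inv_nonsingular(1)[OF C] mat_inv_singular[OF C] by (cases "Determinant.det C = 0") auto

lemma det_mat_inv_nonzero:
  assumes C: "C \<in> carrier_mat n n" and "Determinant.det C \<noteq> 0"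
  shows "Determinant.det (mat_inv C) \<noteq> 0"
proof -
  have "Determinant.det C * Determinant.det (mat_inv C) = 1"
    using Determinant.det_mult[OF C mat_inv_nonsingular(1)[OF assms]] mat_inv_nonsingular(2)[OF assms] by simp
  then show ?thesis by auto
qed

text \<open>
The double inverse recovers an invertible matrix. A singular matrix is sent to zero, and in positive
dimension the zero matrix is singular again.
\<close>

lemma mat_inv_mat_inv:
  assumes C: "C \<in> carrier_mat n n" and n: "0 < n"
  shows "mat_inv (mat_inv C) = (if Determinant.det C = 0 then 0\<^sub>m n n else C)"
proof (cases "Determinant.det C = 0")
  case True
  have "Determinant.det (0\<^sub>m n n :: real mat) = 0" using n by simp
  then show ?thesis using True mat_inv_singular[OF C True] mat_inv_singular[of "0\<^sub>m n n" n] by simp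
next
  case False
  let ?D = "mat_inv C" and ?E = "mat_inv (mat_inv C)"
  note D = mat_inv_nonsingular[OF C False]
  note E = mat_inv_nonsingular[OF D(1) det_mat_inv_nonzero[OF C False]]
  have "?E = (C * ?D) * ?E" using D E by simp
  also have "\<dots> = C * (?D * ?E)" using C D E by (intro assoc_mult_mat)
  also have "\<dots> = C" using C E by simp
  finally show ?thesis using False by simp
qed

lemma l2_norm_eq_L2_set: "l2_norm v = L2_set (vec_index v) {..<dim_vec v}"
  by (simp add: l2_norm_def L2_set_def)

lemma l2_norm_nonneg: "0 \<le> l2_norm v"
  by (simp add: l2_norm_eq_L2_set)

lemma mult_mat_vec_index:
  assumes "C \<in> carrier_mat n n" "w \<in> carrier_vec n" "i < n"
  shows "vec_index (C *\<^sub>v w) i = (\<Sum>j<n. C $$ (i, j) * vec_index w j)"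
  using assms by (auto simp: scalar_prod_def row_def atLeast0LessThan intro!: sum.cong)

lemma scalar_prod_mult_mat_vec:
  assumes "C \<in> carrier_mat n n" "w \<in> carrier_vec n" "x \<in> carrier_vec n"
  shows "scalar_prod x (C *\<^sub>v w) = bilin n (vec_index x) (vec_index w) (\<lambda>ij. C $$ ij)"
  using assms unfolding bilin_def scalar_prod_def
  by (auto simp: atLeast0LessThan mult_mat_vec_index sum_distrib_left mult_ac simp del: index_mult_mat_vec intro!: sum.cong)

text \<open>
The equivalence expresses a bound on the operator norm by countably many linear inequalities in the
entries. This makes the event measurable and gives access to the tail bound for bilinear forms. For the
converse direction, \<open>|C w|\<^sup>2\<close> is the bilinear form of \<open>C\<close> at \<open>C w\<close> and \<open>w\<close>.
\<close>

lemma op_norm_l2_le_iff: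
  assumes C: "C \<in> carrier_mat n n" and \<tau>: "0 \<le> \<tau>"
  shows "op_norm l2_norm C \<le> \<tau> \<longleftrightarrow>
    (\<forall>u\<in>unit_net n. \<forall>v\<in>unit_net n. bilin n u v (\<lambda>ij. C $$ ij) \<le> \<tau>)"
proof -
  let ?B = "{v \<in> carrier_vec (dim_col C). l2_norm v \<le> 1}"
  have dim: "dim_col C = n" "dim_row C = n" using C by auto
  have Cv: "C *\<^sub>v v \<in> carrier_vec n" if "v \<in> carrier_vec n" for v using C that by simp
  show ?thesis
  proof
    assume le: "op_norm l2_norm C \<le> \<tau>"
    show "\<forall>u\<in>unit_net n. \<forall>v\<in>unit_net n. bilin n u v (\<lambda>ij. C $$ ij) \<le> \<tau>"
    proof (intro ballI)
      fix u v assume "u \<in> unit_net n" "v \<in> unit_net n"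
      then have 1: "(\<Sum>i<n. (u i)\<^sup>2) = 1" "(\<Sum>i<n. (v i)\<^sup>2) = 1" by (auto dest: unit_net_unit)
      let ?v = "vec n v" and ?u = "vec n u"
      have v: "?v \<in> ?B" using 1 by (simp add: dim l2_norm_def)
      \<comment> \<open>Without boundedness the supremum in \<open>op_norm\<close> would carry no information.\<close>
      have "bdd_above ((\<lambda>v. l2_norm (C *\<^sub>v v)) ` ?B)"
      proof (rule bdd_aboveI2)
        fix w assume w: "w \<in> ?B"
        then have wc: "w \<in> carrier_vec n" by (simp add: dim)
        have "\<bar>vec_index w j\<bar> \<le> 1" if "j < n" for j
        proof -
          have "\<bar>vec_index w j\<bar> \<le> L2_set (\<lambda>j. \<bar>vec_index w j\<bar>) {..<n}"
            using that by (intro member_le_L2_set) auto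
          also have "\<dots> = l2_norm w"
            using wc by (simp add: l2_norm_eq_L2_set L2_set_def)
          finally have "\<bar>vec_index w j\<bar> \<le> l2_norm w" .
          then show ?thesis using w by simp
        qed
        then have "\<bar>vec_index (C *\<^sub>v w) i\<bar> \<le> (\<Sum>j<n. \<bar>C $$ (i, j)\<bar>)" if "i < n" for i
          unfolding mult_mat_vec_index[OF C wc that]
          by (intro order.trans[OF sum_abs] sum_mono) (auto simp: abs_mult intro!: mult_left_le)
        then have "(\<Sum>i<n. \<bar>vec_index (C *\<^sub>v w) i\<bar>) \<le> (\<Sum>i<n. \<Sum>j<n. \<bar>C $$ (i, j)\<bar>)"
          by (intro sum_mono) auto
        moreover have "l2_norm (C *\<^sub>v w) \<le> (\<Sum>i<n. \<bar>vec_index (C *\<^sub>v w) i\<bar>)"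
          unfolding l2_norm_eq_L2_set using C by (simp add: L2_set_le_sum_abs del: index_mult_mat_vec)
        ultimately show "l2_norm (C *\<^sub>v w) \<le> (\<Sum>i<n. \<Sum>j<n. \<bar>C $$ (i, j)\<bar>)" by linarith
      qed
      then have "l2_norm (C *\<^sub>v ?v) \<le> \<tau>"
        using cSUP_upper[OF v] le unfolding op_norm_def by (blast intro: order.trans)
      have "bilin n u v (\<lambda>ij. C $$ ij) = (\<Sum>i<n. u i * vec_index (C *\<^sub>v ?v) i)"
        by (simp add: bilin_def mult_mat_vec_index[OF C] sum_distrib_left mult_ac del: index_mult_mat_vec)
      also have "\<dots> \<le> (\<Sum>i<n. \<bar>u i\<bar> * \<bar>vec_index (C *\<^sub>v ?v) i\<bar>)"
        by (intro sum_mono) (metis abs_ge_self abs_mult)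
      also have "\<dots> \<le> L2_set u {..<n} * L2_set (vec_index (C *\<^sub>v ?v)) {..<n}"
        by (rule L2_set_mult_ineq)
      also have "\<dots> = l2_norm (C *\<^sub>v ?v)"
        using C 1 by (simp add: l2_norm_eq_L2_set L2_set_def[of u])
      finally show "bilin n u v (\<lambda>ij. C $$ ij) \<le> \<tau>" using \<open>l2_norm (C *\<^sub>v ?v) \<le> \<tau>\<close> by linarith
    qed
  next
    assume net: "\<forall>u\<in>unit_net n. \<forall>v\<in>unit_net n. bilin n u v (\<lambda>ij. C $$ ij) \<le> \<tau>"
    show "op_norm l2_norm C \<le> \<tau>"
      unfolding op_norm_def
    proof (rule cSUP_least)
      have "0\<^sub>v n \<in> ?B" by (simp add: dim l2_norm_def)
      then show "?B \<noteq> {}" by blast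
    next
      fix w assume w: "w \<in> ?B"
      then have wc: "w \<in> carrier_vec n" by (simp add: dim)
      let ?y = "C *\<^sub>v w"
      have yc: "?y \<in> carrier_vec n" by (rule Cv[OF wc])
      have nsq: "(\<Sum>i<n. (vec_index x i)\<^sup>2) = (l2_norm x)\<^sup>2" if "x \<in> carrier_vec n" for x
        using that by (simp add: l2_norm_def sum_nonneg)
      have "(l2_norm ?y)\<^sup>2 = bilin n (vec_index ?y) (vec_index w) (\<lambda>ij. C $$ ij)"
        unfolding scalar_prod_mult_mat_vec[OF C wc yc, symmetric] nsq[OF yc, symmetric]
        using yc C by (simp add: scalar_prod_def atLeast0LessThan power2_eq_square)
      also have "\<dots> \<le> \<tau> * (sqrt (\<Sum>i<n. (vec_index ?y i)\<^sup>2) * sqrt (\<Sum>i<n. (vec_index w i)\<^sup>2))"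
        using net by (intro bilin_le_if_net_le \<tau>) auto
      also have "\<dots> = \<tau> * (l2_norm ?y * l2_norm w)"
        unfolding nsq[OF yc] nsq[OF wc] by (simp add: l2_norm_nonneg)
      also have "\<dots> \<le> \<tau> * (l2_norm ?y * 1)"
        using w \<tau> by (intro mult_left_mono) (auto simp: l2_norm_nonneg)
      finally have *: "l2_norm ?y * l2_norm ?y \<le> \<tau> * l2_norm ?y" by (simp add: power2_eq_square)
      show "l2_norm ?y \<le> \<tau>"
      proof (cases "l2_norm ?y = 0")
        case False
        then have "0 < l2_norm ?y" using l2_norm_nonneg[of ?y] by simp
        then show ?thesis using * by simp
      qed (use \<tau> in simp)
    qed
  qed
qed

section \<open>Random matrices with independent standard normal entries\<close>

text \<open>
The restriction produces an extensional function, an element of the space of the product measure.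
\<close>

definition entries :: "nat \<Rightarrow> real mat \<Rightarrow> nat \<times> nat \<Rightarrow> real" where
  "entries n C = restrict (\<lambda>ij. C $$ ij) (square n)"

lemma mat_entries: "C \<in> carrier_mat n n \<Longrightarrow> mat n n (entries n C) = C"
  unfolding entries_def mat_restrict_square by (auto intro: eq_matI)

lemma det_fun_entries: "C \<in> carrier_mat n n \<Longrightarrow> det_fun n (entries n C) = Determinant.det C"
  by (simp add: det_fun_def mat_entries)

text \<open>
Independence says that the joint distribution of the entries is the product of their distributions.
\<close>

lemma standard_normal_matrix_distr:
  assumes "prob_space M" and X: "standard_normal_matrix M n X" and n: "0 < n"
  shows "(\<lambda>\<omega>. entries n (X \<omega>)) \<in> M \<rightarrow>\<^sub>M gaussian (square n)"
    and "distr M (gaussian (square n)) (\<lambda>\<omega>. entries n (X \<omega>)) = gaussian (square n)"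
proof -
  interpret prob_space M by fact
  have indep: "indep_vars (\<lambda>_. borel) (\<lambda>ij \<omega>. X \<omega> $$ ij) (square n)"
    and dist: "\<And>ij. ij \<in> square n \<Longrightarrow> distributed M lborel (\<lambda>\<omega>. X \<omega> $$ ij) std_normal_density"
    using X unfolding standard_normal_matrix_def by auto
  have rv: "(\<lambda>\<omega>. X \<omega> $$ ij) \<in> borel_measurable M" if "ij \<in> square n" for ij
    using indep that unfolding indep_vars_def by auto
  have d: "distr M borel (\<lambda>\<omega>. X \<omega> $$ ij) = std_gaussian" if "ij \<in> square n" for ij
  proof -
    have "distr M borel (\<lambda>\<omega>. X \<omega> $$ ij) = distr M lborel (\<lambda>\<omega>. X \<omega> $$ ij)"
      by (rule distr_cong) auto
    then show ?thesis using dist[OF that] by (simp add: distributed_def std_gaussian_def)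
  qed
  have meas: "(\<lambda>\<omega>. entries n (X \<omega>)) \<in> M \<rightarrow>\<^sub>M PiM (square n) (\<lambda>_. borel)"
    unfolding entries_def by (intro measurable_restrict rv)
  then show "(\<lambda>\<omega>. entries n (X \<omega>)) \<in> M \<rightarrow>\<^sub>M gaussian (square n)"
    using measurable_cong_sets[OF refl sets_gaussian] by blast
  have "distr M (gaussian (square n)) (\<lambda>\<omega>. entries n (X \<omega>))
      = distr M (PiM (square n) (\<lambda>_. borel)) (\<lambda>\<omega>. \<lambda>ij\<in>square n. X \<omega> $$ ij)"
    by (rule distr_cong) (auto simp: sets_gaussian entries_def)
  also have "\<dots> = PiM (square n) (\<lambda>ij. distr M borel (\<lambda>\<omega>. X \<omega> $$ ij))"
    using indep n by (subst indep_vars_iff_distr_eq_PiM'[symmetric]) (auto intro: rv)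
  also have "\<dots> = gaussian (square n)"
    unfolding gaussian_def by (intro PiM_cong refl d)
  finally show "distr M (gaussian (square n)) (\<lambda>\<omega>. entries n (X \<omega>)) = gaussian (square n)" .
qed

lemma AE_standard_normal_matrix:
  assumes "prob_space M" "standard_normal_matrix M n X" "0 < n"
    and "AE \<xi> in gaussian (square n). Q \<xi>"
  shows "AE \<omega> in M. Q (entries n (X \<omega>))"
  by (rule AE_distrD[OF standard_normal_matrix_distr(1)[OF assms(1-3)]])
    (simp only: standard_normal_matrix_distr(2)[OF assms(1-3)] assms(4))

lemma standard_normal_matrix_carrier:
  "standard_normal_matrix M n X \<Longrightarrow> \<omega> \<in> space M \<Longrightarrow> X \<omega> \<in> carrier_mat n n"
  by (simp add: standard_normal_matrix_def)

lemma AE_standard_normal_matrix_det: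
  assumes "prob_space M" "standard_normal_matrix M n X" "0 < n"
  shows "AE \<omega> in M. Determinant.det (X \<omega>) \<noteq> 0"
  using AE_standard_normal_matrix[OF assms AE_det_fun_nonzero] AE_space
  by eventually_elim (simp add: det_fun_entries standard_normal_matrix_carrier[OF assms(2)])

text \<open>
The value of \<open>\<Phi>\<close> at the zero matrix, taken when \<open>X\<close> is singular, affects neither integrability nor the
integral, because the determinant is almost surely nonzero.
\<close>

lemma standard_normal_matrix_integral:
  fixes \<Phi> :: "real mat \<Rightarrow> real"
  assumes "prob_space M" and X: "standard_normal_matrix M n X" and n: "0 < n"
    and g: "exp_growth (square n) g"
    and \<Phi>: "\<And>C. C \<in> carrier_mat n n \<Longrightarrow> \<Phi> C = g (entries n C)"
  shows "has_bochner_integral M (\<lambda>\<omega>. \<Phi> (mat_inv (mat_inv (X \<omega>)))) (\<integral>\<xi>. g \<xi> \<partial>gaussian (square n))"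
proof -
  note distr = standard_normal_matrix_distr[OF assms(1-3)]
  note carr = standard_normal_matrix_carrier[OF X]
  note [measurable] = distr(1) exp_growth_measurable[OF g]
  let ?h = "\<lambda>\<xi>. if det_fun n \<xi> = 0 then \<Phi> (0\<^sub>m n n) else g \<xi>"
  have eq: "\<Phi> (mat_inv (mat_inv (X \<omega>))) = ?h (entries n (X \<omega>))" if "\<omega> \<in> space M" for \<omega>
    using carr[OF that] by (simp add: mat_inv_mat_inv[OF _ n] det_fun_entries \<Phi>)
  have int: "has_bochner_integral (gaussian (square n)) g (\<integral>\<xi>. g \<xi> \<partial>gaussian (square n))"
    by (intro has_bochner_integral_integrable exp_growth_integrable g) simp
  have meas: "?h \<in> borel_measurable (gaussian (square n))" by measurable
  have "has_bochner_integral (gaussian (square n)) ?h (\<integral>\<xi>. g \<xi> \<partial>gaussian (square n))"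
  proof (rule has_bochner_integral_cong_AE[THEN iffD1, OF _ meas _ int])
    show "AE \<xi> in gaussian (square n). g \<xi> = ?h \<xi>"
      using AE_det_fun_nonzero[of n] by eventually_elim simp
  qed measurable
  then have "has_bochner_integral M (\<lambda>\<omega>. ?h (entries n (X \<omega>))) (\<integral>\<xi>. g \<xi> \<partial>gaussian (square n))"
    using integrable_distr_eq[OF distr(1) meas] integral_distr[OF distr(1) meas]
    unfolding has_bochner_integral_iff distr(2) by simp
  then show ?thesis
    by (rule has_bochner_integral_cong[THEN iffD1, rotated -1]) (auto simp: eq)
qed

lemma standard_normal_matrix_norm_tail:
  assumes "prob_space M" and X: "standard_normal_matrix M n X" and n: "0 < n" and \<epsilon>: "0 < \<epsilon>"
  shows "measure M {\<omega> \<in> space M. op_norm l2_norm (mat_inv (mat_inv (X \<omega>))) \<le> 2 * sqrt (real n) + \<epsilon>}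
    \<ge> 1 - exp (- \<epsilon>\<^sup>2 / 2)"
proof -
  interpret prob_space M by fact
  note distr = standard_normal_matrix_distr[OF assms(1-3)]
  note carr = standard_normal_matrix_carrier[OF X]
  note [measurable] = distr(1)
  let ?\<tau> = "2 * sqrt (real n) + \<epsilon>"
  let ?G = "gaussian (square n)"
  let ?E = "{\<xi> \<in> space ?G. \<forall>u\<in>unit_net n. \<forall>v\<in>unit_net n. bilin n u v \<xi> \<le> ?\<tau>}"
  let ?E' = "{\<xi> \<in> space ?G. det_fun n \<xi> = 0 \<or> (\<forall>u\<in>unit_net n. \<forall>v\<in>unit_net n. bilin n u v \<xi> \<le> ?\<tau>)}"
  have \<tau>: "0 \<le> ?\<tau>" using \<epsilon> by simp
  have E: "?E \<in> sets ?G"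
    by (intro sets.sets_Collect_countable_All' countable_unit_net) measurable
  have D: "{\<xi> \<in> space ?G. det_fun n \<xi> = 0} \<in> sets ?G" by measurable
  have E': "?E' \<in> sets ?G"
    by (rule sets.sets_Collect_disj[OF E D])
  have net: "(\<forall>u\<in>unit_net n. \<forall>v\<in>unit_net n. bilin n u v (entries n C) \<le> ?\<tau>) \<longleftrightarrow> op_norm l2_norm C \<le> ?\<tau>"
    if "C \<in> carrier_mat n n" for C
    unfolding op_norm_l2_le_iff[OF that \<tau>] entries_def bilin_restrict ..
  have zero: "op_norm l2_norm (0\<^sub>m n n) \<le> ?\<tau>"
    unfolding op_norm_l2_le_iff[OF zero_carrier_mat \<tau>] using \<tau> by (simp add: bilin_def)
  have "1 - exp (- \<epsilon>\<^sup>2 / 2) \<le> measure ?G ?E"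
    by (rule gaussian_operator_norm_tail[OF n \<epsilon>])
  also have "\<dots> \<le> measure ?G ?E'"
    using E' by (intro gaussian_prob.finite_measure_mono) auto
  also have "\<dots> = measure (distr M ?G (\<lambda>\<omega>. entries n (X \<omega>))) ?E'"
    by (simp only: distr(2))
  also have "\<dots> = measure M ((\<lambda>\<omega>. entries n (X \<omega>)) -` ?E' \<inter> space M)"
    by (rule measure_distr[OF distr(1) E'])
  also have "(\<lambda>\<omega>. entries n (X \<omega>)) -` ?E' \<inter> space M =
     {\<omega> \<in> space M. op_norm l2_norm (mat_inv (mat_inv (X \<omega>))) \<le> ?\<tau>}"
  proof -
    have "entries n (X \<omega>) \<in> ?E' \<longleftrightarrow> op_norm l2_norm (mat_inv (mat_inv (X \<omega>))) \<le> ?\<tau>" if "\<omega> \<in> space M" for \<omega>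
      unfolding mem_Collect_eq net[OF carr[OF that]] det_fun_entries[OF carr[OF that]]
        mat_inv_mat_inv[OF carr[OF that] n]
      using measurable_space[OF distr(1) that] zero by simp
    then show ?thesis by blast
  qed
  finally show ?thesis .
qed

lemma linform_square: "linform (square n) w \<xi> = (\<Sum>i<n. \<Sum>j<n. w (i, j) * \<xi> (i, j))"
  unfolding linform_def sum.cartesian_product by (simp add: case_prod_unfold)

text \<open>
With these weights and those of \<open>col_weight\<close>, the numbers \<open>(G b)\<^sub>i\<close> and \<open>(G\<^sup>T c)\<^sub>i\<close> are linear forms in
the entries of \<open>G\<close>.
\<close>

definition row_weight :: "real vec \<Rightarrow> nat \<Rightarrow> nat \<times> nat \<Rightarrow> real" where
  "row_weight w i = (\<lambda>(k, j). if k = i then vec_index w j else 0)"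

definition col_weight :: "real vec \<Rightarrow> nat \<Rightarrow> nat \<times> nat \<Rightarrow> real" where
  "col_weight w i = (\<lambda>(j, k). if k = i then vec_index w j else 0)"

lemma l2_sq: "w \<in> carrier_vec n \<Longrightarrow> (l2_norm w)\<^sup>2 = (\<Sum>i<n. (vec_index w i)\<^sup>2)"
  by (simp add: l2_norm_def sum_nonneg)

text \<open>
Since the transposed identity disappears, the squared norm is \<open>\<Sum>\<^sub>i (G b)\<^sub>i\<^sup>2 (G\<^sup>T c)\<^sub>i\<^sup>2\<close>. The two linear forms
in a summand share the entry \<open>G\<^sub>i\<^sub>i\<close>; this only increases the mixed fourth moment, by
\<open>2 b\<^sub>i\<^sup>2 c\<^sub>i\<^sup>2\<close>.
\<close>

lemma gradient_expectation:
  assumes M: "prob_space M" and X: "standard_normal_matrix M n X" and n: "0 < n"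
    and b: "b \<in> carrier_vec n" and c: "c \<in> carrier_vec n"
  shows "integrable M (\<lambda>\<omega>. (l2_norm (transpose_mat (1\<^sub>m n) *\<^sub>v
           ((mat_inv (mat_inv (X \<omega>)) *\<^sub>v b) \<odot> (transpose_mat (mat_inv (mat_inv (X \<omega>))) *\<^sub>v c))))\<^sup>2)"
    and "real n * (l2_norm b)\<^sup>2 * (l2_norm c)\<^sup>2 \<le>
      (\<integral>\<omega>. (l2_norm (transpose_mat (1\<^sub>m n) *\<^sub>v
           ((mat_inv (mat_inv (X \<omega>)) *\<^sub>v b) \<odot> (transpose_mat (mat_inv (mat_inv (X \<omega>))) *\<^sub>v c))))\<^sup>2 \<partial>M)"
proof -
  let ?\<Phi> = "\<lambda>C. (l2_norm (transpose_mat (1\<^sub>m n) *\<^sub>v ((C *\<^sub>v b) \<odot> (transpose_mat C *\<^sub>v c))))\<^sup>2"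
  let ?R = "\<lambda>i. linform (square n) (row_weight b i)" and ?K = "\<lambda>i. linform (square n) (col_weight c i)"
  let ?g = "\<lambda>\<xi>. \<Sum>i<n. (?R i \<xi>)\<^sup>2 * (?K i \<xi>)\<^sup>2"
  have growth: "exp_growth (square n) (\<lambda>\<xi>. (?R i \<xi>)\<^sup>2 * (?K i \<xi>)\<^sup>2)" for i
    by (intro exp_growth_mult exp_growth_power exp_growth_linform) auto
  have \<Phi>: "?\<Phi> C = ?g (entries n C)" if C: "C \<in> carrier_mat n n" for C
  proof -
    have Ct: "transpose_mat C \<in> carrier_mat n n" using C by simp
    have R: "?R i (entries n C) = vec_index (C *\<^sub>v b) i" if "i < n" for i
    proof -
      have "?R i (entries n C) = (\<Sum>k<n. if k = i then (\<Sum>j<n. vec_index b j * C $$ (i, j)) else 0)"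
        unfolding linform_square row_weight_def by (intro sum.cong) (auto simp: entries_def)
      then show ?thesis using that unfolding mult_mat_vec_index[OF C b that] by (simp add: mult.commute)
    qed
    have K: "?K i (entries n C) = vec_index (transpose_mat C *\<^sub>v c) i" if "i < n" for i
    proof -
      have "?K i (entries n C) = (\<Sum>j<n. \<Sum>k<n. if k = i then vec_index c j * C $$ (j, k) else 0)"
        unfolding linform_square col_weight_def by (intro sum.cong) (auto simp: entries_def)
      then show ?thesis using that C unfolding mult_mat_vec_index[OF Ct c that] by (simp add: mult.commute)
    qed
    let ?w = "(C *\<^sub>v b) \<odot> (transpose_mat C *\<^sub>v c)"
    have w: "?w \<in> carrier_vec n" using C by (simp add: elementwise_prod_def)
    have "?\<Phi> C = (\<Sum>i<n. (vec_index ?w i)\<^sup>2)" using w by (simp add: l2_sq)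
    also have "\<dots> = ?g (entries n C)"
      using C by (intro sum.cong refl) (simp add: R K elementwise_prod_def power_mult_distrib del: index_mult_mat_vec)
    finally show ?thesis .
  qed
  have bi: "has_bochner_integral M (\<lambda>\<omega>. ?\<Phi> (mat_inv (mat_inv (X \<omega>)))) (\<integral>\<xi>. ?g \<xi> \<partial>gaussian (square n))"
  proof (rule standard_normal_matrix_integral[OF M X n])
    show "exp_growth (square n) ?g" by (intro exp_growth_sum growth)
    show "?\<Phi> C = ?g (entries n C)" if "C \<in> carrier_mat n n" for C by (rule \<Phi>[OF that])
  qed
  then show "integrable M (\<lambda>\<omega>. ?\<Phi> (mat_inv (mat_inv (X \<omega>))))"
    by (simp add: has_bochner_integral_iff)
  have row: "(\<Sum>k\<in>square n. (row_weight b i k)\<^sup>2) = (l2_norm b)\<^sup>2" if "i < n" for i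
  proof -
    have "(\<Sum>k\<in>square n. (row_weight b i k)\<^sup>2) = (\<Sum>k<n. \<Sum>j<n. (row_weight b i (k, j))\<^sup>2)"
      unfolding sum.cartesian_product by (simp add: case_prod_unfold)
    also have "\<dots> = (\<Sum>k<n. if k = i then (\<Sum>j<n. (vec_index b j)\<^sup>2) else 0)"
      unfolding row_weight_def by (intro sum.cong) auto
    finally show ?thesis using that b by (simp add: l2_sq)
  qed
  have col: "(\<Sum>k\<in>square n. (col_weight c i k)\<^sup>2) = (l2_norm c)\<^sup>2" if "i < n" for i
  proof -
    have "(\<Sum>k\<in>square n. (col_weight c i k)\<^sup>2) = (\<Sum>j<n. \<Sum>k<n. (col_weight c i (j, k))\<^sup>2)"
      unfolding sum.cartesian_product by (simp add: case_prod_unfold)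
    also have "\<dots> = (\<Sum>j<n. \<Sum>k<n. if k = i then (vec_index c j)\<^sup>2 else 0)"
      unfolding col_weight_def by (intro sum.cong) auto
    finally show ?thesis using that c by (simp add: l2_sq)
  qed
  have "real n * (l2_norm b)\<^sup>2 * (l2_norm c)\<^sup>2 = (\<Sum>i<n. (l2_norm b)\<^sup>2 * (l2_norm c)\<^sup>2)" by simp
  also have "\<dots> \<le> (\<Sum>i<n. (\<integral>\<xi>. (?R i \<xi>)\<^sup>2 * (?K i \<xi>)\<^sup>2 \<partial>gaussian (square n)))"
    by (intro sum_mono) (simp add: gaussian_mixed_fourth_moment row col)
  also have "\<dots> = (\<integral>\<xi>. ?g \<xi> \<partial>gaussian (square n))"
    by (intro Bochner_Integration.integral_sum[symmetric] exp_growth_integrable growth) auto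
  also have "\<dots> = (\<integral>\<omega>. ?\<Phi> (mat_inv (mat_inv (X \<omega>))) \<partial>M)"
    using bi by (simp add: has_bochner_integral_iff)
  finally show "real n * (l2_norm b)\<^sup>2 * (l2_norm c)\<^sup>2 \<le> (\<integral>\<omega>. ?\<Phi> (mat_inv (mat_inv (X \<omega>))) \<partial>M)" .
qed

text \<open>
The output is a linear form in the entries of \<open>G\<close> with weights \<open>c\<^sub>i b\<^sub>j\<close>, and its second moment is the
sum of the squared weights.
\<close>

lemma output_second_moment:
  assumes M: "prob_space M" and X: "standard_normal_matrix M n X" and n: "0 < n"
    and b: "b \<in> carrier_vec n" and c: "c \<in> carrier_vec n"
  shows "has_bochner_integral M (\<lambda>\<omega>. \<bar>scalar_prod c (mat_inv (mat_inv (X \<omega>)) *\<^sub>v b)\<bar>\<^sup>2)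
     ((l2_norm c)\<^sup>2 * (l2_norm b)\<^sup>2)"
proof -
  let ?w = "\<lambda>(i, j). vec_index c i * vec_index b j"
  let ?g = "\<lambda>\<xi>. linform (square n) ?w \<xi> * linform (square n) ?w \<xi>"
  have "has_bochner_integral M (\<lambda>\<omega>. \<bar>scalar_prod c (mat_inv (mat_inv (X \<omega>)) *\<^sub>v b)\<bar>\<^sup>2)
     (\<integral>\<xi>. ?g \<xi> \<partial>gaussian (square n))"
  proof (rule standard_normal_matrix_integral[OF M X n])
    show "exp_growth (square n) ?g" by (intro exp_growth_mult exp_growth_linform) auto
    show "\<bar>scalar_prod c (C *\<^sub>v b)\<bar>\<^sup>2 = ?g (entries n C)" if "C \<in> carrier_mat n n" for C
      unfolding scalar_prod_mult_mat_vec[OF that b c] bilin_eq_linform[symmetric] entries_def bilin_restrict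
      by (simp add: power2_eq_square)
  qed
  also have "(\<integral>\<xi>. ?g \<xi> \<partial>gaussian (square n)) = (\<Sum>k\<in>square n. ?w k * ?w k)"
    by (rule gaussian_covariance) simp
  also have "\<dots> = (\<Sum>i<n. \<Sum>j<n. (vec_index c i)\<^sup>2 * (vec_index b j)\<^sup>2)"
    unfolding sum.cartesian_product by (intro sum.cong) (auto simp: power2_eq_square)
  also have "\<dots> = (l2_norm c)\<^sup>2 * (l2_norm b)\<^sup>2"
    unfolding l2_sq[OF b] l2_sq[OF c] by (simp add: sum_product)
  finally show ?thesis .
qed

section \<open>Norms and asymptotic bounds\<close>

lemma linf_norm_nonneg: "0 \<le> linf_norm w"
  unfolding linf_norm_def by (rule Max_ge) auto

lemma l1_norm_nonneg: "0 \<le> l1_norm w"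
  unfolding l1_norm_def by (intro sum_nonneg) auto

lemma abs_index_le_linf_norm: "i < dim_vec w \<Longrightarrow> \<bar>vec_index w i\<bar> \<le> linf_norm w"
  unfolding linf_norm_def by (rule Max_ge) auto

lemma linf_norm_le_l2_norm: "linf_norm w \<le> l2_norm w"
proof -
  have "\<bar>vec_index w i\<bar> \<le> l2_norm w" if "i < dim_vec w" for i
  proof -
    have "(vec_index w i)\<^sup>2 \<le> (\<Sum>j<dim_vec w. (vec_index w j)\<^sup>2)"
      using that by (intro member_le_sum) auto
    then show ?thesis unfolding l2_norm_def by (intro real_le_rsqrt) simp
  qed
  then show ?thesis unfolding linf_norm_def by (auto simp: l2_norm_nonneg)
qed

lemma l2_norm_sq_le: "(l2_norm w)\<^sup>2 \<le> linf_norm w * l1_norm w"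
proof -
  have "(l2_norm w)\<^sup>2 = (\<Sum>i<dim_vec w. \<bar>vec_index w i\<bar> * \<bar>vec_index w i\<bar>)"
    by (simp add: l2_norm_def sum_nonneg power2_eq_square)
  also have "\<dots> \<le> (\<Sum>i<dim_vec w. linf_norm w * \<bar>vec_index w i\<bar>)"
    by (intro sum_mono mult_right_mono abs_index_le_linf_norm) auto
  finally show ?thesis by (simp add: l1_norm_def sum_distrib_left)
qed

lemma op_norm_one_mat_bounded:
  assumes nonneg: "\<And>w. 0 \<le> N w" and zero: "\<And>n. N (0\<^sub>v n) = 0"
  shows "(\<lambda>n. op_norm N (1\<^sub>m n)) \<in> O(\<lambda>_. 1)"
proof (rule bigoI[where c = 1], rule always_eventually, rule allI)
  fix n
  let ?B = "{v \<in> carrier_vec n. N v \<le> 1}"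
  have mem: "0\<^sub>v n \<in> ?B" by (simp add: zero)
  have eq: "op_norm N (1\<^sub>m n) = (SUP v\<in>?B. N v)"
    unfolding op_norm_def by (rule SUP_cong) auto
  have "(SUP v\<in>?B. N v) \<le> 1"
  proof (rule cSUP_least)
    show "?B \<noteq> {}" using mem by blast
  qed simp
  moreover have "N (0\<^sub>v n) \<le> (SUP v\<in>?B. N v)"
    by (rule cSUP_upper[OF mem]) (auto intro: bdd_aboveI2)
  ultimately show "norm (op_norm N (1\<^sub>m n)) \<le> 1 * norm (1::real)"
    unfolding eq using zero[of n] by simp
qed

lemma linf_norm_zero: "linf_norm (0\<^sub>v n) = 0"
proof (rule antisym)
  show "linf_norm (0\<^sub>v n) \<le> 0"
    unfolding linf_norm_def by (rule Max.boundedI) auto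
qed (rule linf_norm_nonneg)

lemma l1_norm_zero: "l1_norm (0\<^sub>v n) = 0"
  by (simp add: l1_norm_def)

lemma l2_norm_zero: "l2_norm (0\<^sub>v n) = 0"
  by (simp add: l2_norm_def)

lemma bigtheta_one_bounds:
  fixes h :: "nat \<Rightarrow> real"
  assumes "h \<in> \<Theta>(\<lambda>_. 1)" "\<And>n. 0 \<le> h n"
  obtains k K where "0 < k" "0 < K" "\<forall>\<^sub>F n in sequentially. k \<le> h n \<and> h n \<le> K"
proof -
  from assms(1) have "h \<in> O(\<lambda>_. 1)" "h \<in> \<Omega>(\<lambda>_. 1)" by (auto simp: bigtheta_def)
  obtain K where K: "0 < K" "\<forall>\<^sub>F n in sequentially. norm (h n) \<le> K * norm (1::real)"
    using landau_o.bigE[OF \<open>h \<in> O(\<lambda>_. 1)\<close>] by blast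
  obtain k where k: "0 < k" "\<forall>\<^sub>F n in sequentially. norm (h n) \<ge> k * norm (1::real)"
    using landau_omega.bigE[OF \<open>h \<in> \<Omega>(\<lambda>_. 1)\<close>] by blast
  have "\<forall>\<^sub>F n in sequentially. k \<le> h n \<and> h n \<le> K"
    using k(2) K(2) by eventually_elim (simp add: abs_of_nonneg[OF assms(2)])
  then show ?thesis by (rule that[OF k(1) K(1)])
qed

section \<open>Averaged convergence conditions of the Gaussian family\<close>

theorem proposition1:
  fixes M :: "'w measure"
    and f :: "real \<Rightarrow> real" and L \<mu> :: real
    and b c :: "nat \<Rightarrow> real vec"
    and G A :: "nat \<Rightarrow> 'w \<Rightarrow> real mat" and B :: "nat \<Rightarrow> real mat"
    and P :: "'w \<Rightarrow> nat \<Rightarrow> design_problem"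
  assumes "prob_space M"
    and "lipschitz_smooth L f" and "strongly_convex \<mu> f" and "bdd_below (range f)"
    and "\<And>n. n > 0 \<Longrightarrow> b n \<in> carrier_vec n" and "\<And>n. n > 0 \<Longrightarrow> c n \<in> carrier_vec n"
    and "(\<lambda>n. linf_norm (b n)) \<in> \<Theta>(\<lambda>_. 1)" and "(\<lambda>n. l1_norm (b n)) \<in> \<Theta>(\<lambda>_. 1)"
    and "(\<lambda>n. linf_norm (c n)) \<in> \<Theta>(\<lambda>_. 1)" and "(\<lambda>n. l1_norm (c n)) \<in> \<Theta>(\<lambda>_. 1)"
    and "\<And>n. n > 0 \<Longrightarrow> standard_normal_matrix M n (G n)"
    and "\<And>n \<omega>. A n \<omega> = mat_inv (G n \<omega>)"
    and "\<And>n. B n = 1\<^sub>m n"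
    and "\<And>\<omega> n. P \<omega> n =
           \<lparr>objective = f, readout = c n,
            system = \<lparr>sys_A = A n \<omega>, sys_B = B n, sys_b = b n\<rparr>\<rparr>"
  shows
    "(\<forall>n>0. AE \<omega> in M. invertible_mat (G n \<omega>)) \<and>
     (\<forall>n>0. \<forall>\<epsilon>>0.
        measure M {\<omega> \<in> space M. op_norm l2_norm (mat_inv (A n \<omega>)) \<le> 2 * sqrt (real n) + \<epsilon>}
          \<ge> 1 - 2 * exp (- \<epsilon>\<^sup>2 / 2)) \<and>
     (\<forall>n>0. integrable M (\<lambda>\<omega>.
        (l2_norm (transpose_mat (B n) *\<^sub>v
           ((mat_inv (A n \<omega>) *\<^sub>v b n) \<odot> (transpose_mat (mat_inv (A n \<omega>)) *\<^sub>v c n))))\<^sup>2)) \<and>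
     (\<lambda>n. \<integral>\<omega>.
        (l2_norm (transpose_mat (B n) *\<^sub>v
           ((mat_inv (A n \<omega>) *\<^sub>v b n) \<odot> (transpose_mat (mat_inv (A n \<omega>)) *\<^sub>v c n))))\<^sup>2 \<partial>M)
       \<in> \<Omega>(\<lambda>n. real n) \<and>
     (\<forall>n>0. integrable M (\<lambda>\<omega>. \<bar>scalar_prod (c n) (mat_inv (A n \<omega>) *\<^sub>v b n)\<bar>\<^sup>2)) \<and>
     (\<lambda>n. \<integral>\<omega>. \<bar>scalar_prod (c n) (mat_inv (A n \<omega>) *\<^sub>v b n)\<bar>\<^sup>2 \<partial>M) \<in> O(\<lambda>_. 1) \<and>
     average_asymptotic_convergence_conditions M (1/2) (1/2) L \<mu> f P"
proof -
  let ?grad = "\<lambda>n \<omega>. (l2_norm (transpose_mat (B n) *\<^sub>v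
           ((mat_inv (A n \<omega>) *\<^sub>v b n) \<odot> (transpose_mat (mat_inv (A n \<omega>)) *\<^sub>v c n))))\<^sup>2"
  let ?out = "\<lambda>n \<omega>. \<bar>scalar_prod (c n) (mat_inv (A n \<omega>) *\<^sub>v b n)\<bar>\<^sup>2"
  note prob = assms(1) and b = assms(5) and c = assms(6) and G = assms(11)
    and A = assms(12) and B = assms(13) and P = assms(14)
  interpret prob_space M by (rule prob)
  have carr: "G n \<omega> \<in> carrier_mat n n" if "0 < n" "\<omega> \<in> space M" for n \<omega>
    using standard_normal_matrix_carrier[OF G] that by blast
  have det: "AE \<omega> in M. Determinant.det (G n \<omega>) \<noteq> 0" if "0 < n" for n
    by (rule AE_standard_normal_matrix_det[OF prob G[OF that] that])
  have inv_G: "AE \<omega> in M. invertible_mat (G n \<omega>)" if "0 < n" for n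
    using det[OF that] AE_space
    by eventually_elim (simp add: invertible_mat_iff_det[OF carr[OF that]])
  have inv_A: "AE \<omega> in M. invertible_mat (A n \<omega>)" if "0 < n" for n
    using det[OF that] AE_space
    by eventually_elim (simp add: A invertible_mat_iff_det[OF mat_inv_carrier[OF carr[OF that]]]
      det_mat_inv_nonzero[OF carr[OF that]])
  have tail: "measure M {\<omega> \<in> space M. op_norm l2_norm (mat_inv (A n \<omega>)) \<le> 2 * sqrt (real n) + \<epsilon>}
      \<ge> 1 - 2 * exp (- \<epsilon>\<^sup>2 / 2)" if "0 < n" "0 < \<epsilon>" for n \<epsilon>
    using standard_normal_matrix_norm_tail[OF prob G[OF that(1)] that] exp_gt_zero[of "- \<epsilon>\<^sup>2 / 2"]
    unfolding A by linarith
  have grad: "integrable M (?grad n)" "real n * (l2_norm (b n))\<^sup>2 * (l2_norm (c n))\<^sup>2 \<le> (\<integral>\<omega>. ?grad n \<omega> \<partial>M)"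
    if "0 < n" for n
    using gradient_expectation[OF prob G[OF that] that b[OF that] c[OF that]] unfolding A B by blast+
  have out: "integrable M (?out n)" "(\<integral>\<omega>. ?out n \<omega> \<partial>M) = (l2_norm (c n))\<^sup>2 * (l2_norm (b n))\<^sup>2"
    if "0 < n" for n
    using output_second_moment[OF prob G[OF that] that b[OF that] c[OF that]]
    unfolding A by (auto simp: has_bochner_integral_iff)
  obtain kb Kb where kb: "0 < kb" "0 < Kb" "\<forall>\<^sub>F n in sequentially. kb \<le> linf_norm (b n) \<and> linf_norm (b n) \<le> Kb"
    by (rule bigtheta_one_bounds[OF assms(7) linf_norm_nonneg])
  obtain kb' Kb' where kb': "0 < kb'" "0 < Kb'" "\<forall>\<^sub>F n in sequentially. kb' \<le> l1_norm (b n) \<and> l1_norm (b n) \<le> Kb'"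
    by (rule bigtheta_one_bounds[OF assms(8) l1_norm_nonneg])
  obtain kc Kc where kc: "0 < kc" "0 < Kc" "\<forall>\<^sub>F n in sequentially. kc \<le> linf_norm (c n) \<and> linf_norm (c n) \<le> Kc"
    by (rule bigtheta_one_bounds[OF assms(9) linf_norm_nonneg])
  obtain kc' Kc' where kc': "0 < kc'" "0 < Kc'" "\<forall>\<^sub>F n in sequentially. kc' \<le> l1_norm (c n) \<and> l1_norm (c n) \<le> Kc'"
    by (rule bigtheta_one_bounds[OF assms(10) l1_norm_nonneg])
  have lower: "\<forall>\<^sub>F n in sequentially. kb\<^sup>2 * kc\<^sup>2 * norm (real n) \<le> norm (\<integral>\<omega>. ?grad n \<omega> \<partial>M)"
    using kb(3) kc(3) eventually_gt_at_top[of 0]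
  proof eventually_elim
    fix n :: nat
    assume bn: "kb \<le> linf_norm (b n) \<and> linf_norm (b n) \<le> Kb"
      and cn: "kc \<le> linf_norm (c n) \<and> linf_norm (c n) \<le> Kc" and n: "0 < n"
    have "kb \<le> l2_norm (b n)" "kc \<le> l2_norm (c n)"
      using bn cn linf_norm_le_l2_norm[of "b n"] linf_norm_le_l2_norm[of "c n"] by linarith+
    then have "kb\<^sup>2 * kc\<^sup>2 \<le> (l2_norm (b n))\<^sup>2 * (l2_norm (c n))\<^sup>2"
      using kb(1) kc(1) by (intro mult_mono power_mono) auto
    then have "real n * (kb\<^sup>2 * kc\<^sup>2) \<le> real n * ((l2_norm (b n))\<^sup>2 * (l2_norm (c n))\<^sup>2)"
      by (rule mult_left_mono) simp
    then have "real n * (kb\<^sup>2 * kc\<^sup>2) \<le> (\<integral>\<omega>. ?grad n \<omega> \<partial>M)"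
      using grad(2)[OF n] by (simp only: mult.assoc)
    then show "kb\<^sup>2 * kc\<^sup>2 * norm (real n) \<le> norm (\<integral>\<omega>. ?grad n \<omega> \<partial>M)"
      by (simp add: mult.commute)
  qed
  have grad_Omega: "(\<lambda>n. \<integral>\<omega>. ?grad n \<omega> \<partial>M) \<in> \<Omega>(\<lambda>n. real n)"
    using lower kb(1) kc(1) by (intro landau_omega.bigI[of "kb\<^sup>2 * kc\<^sup>2"]) auto
  have upper: "\<forall>\<^sub>F n in sequentially. norm (\<integral>\<omega>. ?out n \<omega> \<partial>M) \<le> (Kc * Kc') * (Kb * Kb') * norm (1::real)"
    using kb(3) kb'(3) kc(3) kc'(3) eventually_gt_at_top[of 0]
  proof eventually_elim
    fix n :: nat
    assume bn: "kb \<le> linf_norm (b n) \<and> linf_norm (b n) \<le> Kb" "kb' \<le> l1_norm (b n) \<and> l1_norm (b n) \<le> Kb'"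
      and cn: "kc \<le> linf_norm (c n) \<and> linf_norm (c n) \<le> Kc" "kc' \<le> l1_norm (c n) \<and> l1_norm (c n) \<le> Kc'"
      and n: "0 < n"
    have "(l2_norm (b n))\<^sup>2 \<le> Kb * Kb'"
      using bn kb by (intro order.trans[OF l2_norm_sq_le] mult_mono) (auto simp: l1_norm_nonneg)
    moreover have "(l2_norm (c n))\<^sup>2 \<le> Kc * Kc'"
      using cn kc by (intro order.trans[OF l2_norm_sq_le] mult_mono) (auto simp: l1_norm_nonneg)
    ultimately have "(l2_norm (c n))\<^sup>2 * (l2_norm (b n))\<^sup>2 \<le> (Kc * Kc') * (Kb * Kb')"
      using kc(2) kc'(2) by (intro mult_mono) auto
    then show "norm (\<integral>\<omega>. ?out n \<omega> \<partial>M) \<le> (Kc * Kc') * (Kb * Kb') * norm (1::real)"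
      unfolding out(2)[OF n] by simp
  qed
  have out_O: "(\<lambda>n. \<integral>\<omega>. ?out n \<omega> \<partial>M) \<in> O(\<lambda>_. 1)"
    using upper by (rule bigoI)
  have "average_condition_B M (1/2) P"
    unfolding average_condition_B_def inverse_norm_def P
  proof (intro conjI allI impI exI[of _ "2::real"])
    show "AE \<omega> in M. invertible_mat
        (sys_A (system \<lparr>objective = f, readout = c n, system = \<lparr>sys_A = A n \<omega>, sys_B = B n, sys_b = b n\<rparr>\<rparr>))"
      if "0 < n" for n using inv_A[OF that] by simp
    show "\<forall>\<^sub>F n in sequentially. \<forall>\<epsilon>>0. 1 - 2 * exp (- \<epsilon>\<^sup>2 / 2) \<le> prob {\<omega> \<in> space M. op_norm l2_norm (mat_inv
        (sys_A (system \<lparr>objective = f, readout = c n, system = \<lparr>sys_A = A n \<omega>, sys_B = B n, sys_b = b n\<rparr>\<rparr>)))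
          \<le> 2 * real n powr (1 / 2) + \<epsilon>}"
      using eventually_gt_at_top[of 0] by eventually_elim (use tail in \<open>simp add: powr_half_sqrt\<close>)
  qed simp
  moreover have "average_condition_F M (1/2) (1/2) P"
    unfolding average_condition_F_def gradient_sq_def P Let_def
    using grad(1) grad_Omega by simp
  moreover have "average_condition_G M P"
    unfolding average_condition_G_def abs_output_def P
    using out(1) out_O by simp
  moreover have "is_design_family f (P \<omega>) \<and> condition_C (P \<omega>) \<and> condition_D (P \<omega>) \<and> condition_E (P \<omega>)"
    if \<omega>: "\<omega> \<in> space M" for \<omega>
  proof (intro conjI)
    have "A n \<omega> \<in> carrier_mat n n" if "0 < n" for n
      unfolding A by (rule mat_inv_carrier[OF carr[OF that \<omega>]])
    then have "is_physical_system n n (system (P \<omega> n))" if "0 < n" for n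
      using b[OF that] that by (simp add: is_physical_system_def P B)
    then show "is_design_family f (P \<omega>)"
      using c unfolding is_design_family_def by (auto simp: P)
    show "condition_C (P \<omega>)"
      by (simp add: condition_C_def P B op_norm_one_mat_bounded linf_norm_nonneg l1_norm_nonneg l2_norm_nonneg
          linf_norm_zero l1_norm_zero l2_norm_zero)
    show "condition_D (P \<omega>)" using assms(7,8) by (simp add: condition_D_def P bigtheta_def)
    show "condition_E (P \<omega>)" using assms(9,10) by (simp add: condition_E_def P bigtheta_def)
  qed
  ultimately have "average_asymptotic_convergence_conditions M (1/2) (1/2) L \<mu> f P"
    using assms(2-4) by (simp add: average_asymptotic_convergence_conditions_def condition_A_def)
  then show ?thesis
    using inv_G tail grad(1) grad_Omega out(1) out_O by blast
qed

end
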